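(* For any positive integers $k,l$ with $2\leqslant k\leqslant l$, there exists a constant $c=c(k,l)$ such that every connected balanced $S_{k,l}$-free bipartite graph with minimum degree at least $c$ contains a connected $k$-factor. In particular, $$c=\max\left\{(k^{3}+1)(2l-2k-1)+l,\ 2(k^{2}-k+l)\right\}$$ will do, i.e., the assertion holds with this value of $c$.
   Context: All graphs are finite and simple (no loops or multiple edges). For positive integers $k,l$, $S_{k,l}$ is the graph obtained from disjoint stars $K_{1,k}$ and $K_{1,l}$ by adding an edge between the center of $K_{1,k}$ (the vertex of degree $k$ in it) and the center of $K_{1,l}$ (the vertex of degree $l$ in it). A graph is $F$-free if it contains no induced subgraph isomorphic to $F$. A bipartite graph $G=(X,Y;E)$ with bipartition $(X,Y)$ is balanced if $|X|=|Y|$. A $k$-factor of a graph is a $k$-regular spanning subgraph; a connected $k$-factor is a $k$-factor that is a connected graph. *)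

theory Defs
  imports "Graph_Theory.Digraph_Isomorphism"
begin

text \<open>
  A finite simple graph is a \<^locale>\<open>pair_graph\<close>: a finite, loop-free, symmetric relation on a
  vertex set. An undirected edge is the pair of opposite arcs, so the out-degree of a vertex is its
  degree in the undirected graph, and isomorphism of digraphs is isomorphism of graphs.
\<close>

definition min_degree :: "'a pair_pre_digraph \<Rightarrow> nat" where
  "min_degree G = Min (out_degree (with_proj G) ` pverts G)"

definition regular_graph :: "nat \<Rightarrow> 'a pair_pre_digraph \<Rightarrow> bool" where
  "regular_graph k G \<longleftrightarrow> pair_graph G \<and> (\<forall>v\<in>pverts G. out_degree (with_proj G) v = k)"

definition factor_of :: "nat \<Rightarrow> 'a pair_pre_digraph \<Rightarrow> 'a pair_pre_digraph \<Rightarrow> bool" where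
  "factor_of k H G \<longleftrightarrow> regular_graph k H \<and> spanning (with_proj H) (with_proj G)"

definition bipartition :: "'a pair_pre_digraph \<Rightarrow> 'a set \<Rightarrow> 'a set \<Rightarrow> bool" where
  "bipartition G X Y \<longleftrightarrow>
     pverts G = X \<union> Y \<and> X \<inter> Y = {} \<and> parcs G \<subseteq> X \<times> Y \<union> Y \<times> X"

definition balanced_bipartite :: "'a pair_pre_digraph \<Rightarrow> bool" where
  "balanced_bipartite G \<longleftrightarrow> (\<exists>X Y. bipartition G X Y \<and> card X = card Y)"

definition induced_free :: "'b pair_pre_digraph \<Rightarrow> 'a pair_pre_digraph \<Rightarrow> bool" where
  "induced_free F G \<longleftrightarrow>
     (\<nexists>H. induced_subgraph (with_proj H) (with_proj G) \<and> digraph_iso (with_proj H) (with_proj F))"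

text \<open>The star \<open>K\<^bsub>1,n\<^esub>\<close> with centre \<open>0\<close> and leaves \<open>1, \<dots>, n\<close>.\<close>

definition star :: "nat \<Rightarrow> nat pair_pre_digraph" where
  "star n = \<lparr> pverts = {0..n}, parcs = {0} \<times> {1..n} \<union> {1..n} \<times> {0} \<rparr>"

text \<open>The graph \<open>S\<^bsub>k,l\<^esub>\<close>: disjoint stars whose centres are joined by an edge.\<close>

definition double_star :: "nat \<Rightarrow> nat \<Rightarrow> (nat + nat) pair_pre_digraph" where
  "double_star k l = \<lparr>
     pverts = pverts (star k) <+> pverts (star l),
     parcs = map_prod Inl Inl ` parcs (star k) \<union> map_prod Inr Inr ` parcs (star l)
           \<union> {(Inl 0, Inr 0), (Inr 0, Inl 0)} \<rparr>"

end

theory Submission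
  imports Defs
begin

text \<open>
  Write \<open>N(v)\<close> for the neighbourhood of \<open>v\<close>. In a bipartite graph, being \<open>S\<^bsub>k,l\<^esub>\<close>-free means that
  for every edge \<open>xy\<close>, any \<open>k\<close> further neighbours of \<open>x\<close> and \<open>l\<close> further neighbours of \<open>y\<close> span an edge.

  If there is no \<open>k\<close>-factor, the Ore--Ryser theorem yields sets \<open>S \<subseteq> X\<close>, \<open>T \<subseteq> Y\<close> with
  \<open>|S| + |T| > |X|\<close> and few edges between them. For an extremal such pair every vertex of \<open>S\<close>
  (of \<open>T\<close>) has fewer than \<open>k\<close> neighbours in \<open>T\<close> (in \<open>S\<close>), while the vertices outside have at least
  \<open>k\<close>. Applying the edge condition across \<open>S\<close>, \<open>X - S\<close>, \<open>T\<close> and \<open>Y - T\<close> isolates a nonempty set of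
  vertices that is disjoint from \<open>T\<close> and closed under adjacency, contradicting connectedness.

  Among all \<open>k\<close>-factors choose \<open>F\<close> with the most pairs of vertices joined by a path in \<open>F\<close>. If an edge
  \<open>xy\<close> of the graph crosses between components of \<open>F\<close>, then no \<open>F\<close>-neighbour \<open>a\<close> of \<open>x\<close> is adjacent to
  an \<open>F\<close>-neighbour \<open>b\<close> of \<open>y\<close>, since otherwise replacing \<open>xa, yb\<close> by \<open>xy, ab\<close> merges two components
  (a regular bipartite graph has no bridge). For \<open>k = l\<close> this is already an induced \<open>S\<^bsub>k,k\<^esub>\<close>. For
  \<open>l = k + m\<close> with \<open>m > 0\<close> a double count shows that every vertex lies on at most
  \<open>r = (k + 1)(m - 1) + k\<^sup>2 - k + 1\<close> crossing edges, and all but \<open>k + m - 1\<close> neighbours of \<open>x\<close> lie on a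
  crossing edge with \<open>x\<close> or with one of the \<open>k\<close> vertices \<open>b\<close>. So \<open>x\<close> has degree at most
  \<open>(k + 1) r + l - 1\<close>, which is less than \<open>(k\<^sup>3 + 1)(2m - 1) + l\<close>.
\<close>

section \<open>Degree-bounded subgraphs and deficient pairs\<close>

definition degree_le :: "nat \<Rightarrow> ('a \<times> 'b) set \<Rightarrow> bool" where
  "degree_le k F \<longleftrightarrow> finite F \<and> (\<forall>x. card (F `` {x}) \<le> k) \<and> (\<forall>y. card (F\<inverse> `` {y}) \<le> k)"

text \<open>The walk \<open>p 0, q 0, p 1, q 1, ..., p m, q m\<close> uses edges outside and inside
  \<open>F\<close> in turn, and both its ends have spare degree. Vertices may repeat, so a walk read
  off from reachability qualifies as it stands.\<close>

definition augmenting ::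
    "nat \<Rightarrow> ('a \<times> 'b) set \<Rightarrow> ('a \<times> 'b) set \<Rightarrow> nat \<Rightarrow> (nat \<Rightarrow> 'a) \<Rightarrow> (nat \<Rightarrow> 'b) \<Rightarrow> bool" where
  "augmenting k E F m p q \<longleftrightarrow>
     (\<forall>i\<le>m. (p i, q i) \<in> E - F) \<and> (\<forall>i<m. (p (Suc i), q i) \<in> F) \<and>
     card (F `` {p 0}) < k \<and> card (F\<inverse> `` {q m}) < k"

section \<open>Augmentation along alternating walks\<close>

lemma card_insert_remove1:
  "finite A \<Longrightarrow> a \<in> A \<Longrightarrow> b \<notin> A \<Longrightarrow> card (insert b (A - {a})) = card A"
  by (metis Diff_iff card_insert_disjoint finite_Diff card_Suc_Diff1)

lemma degree_le_insert:
  assumes F: "degree_le k F" and "card (F `` {x}) < k" "card (F\<inverse> `` {y}) < k"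
  shows "degree_le k (insert (x, y) F)"
proof -
  have fin: "finite F" using F by (simp add: degree_le_def)
  have "card (insert (x, y) F `` {u}) \<le> k" for u
  proof (cases "u = x")
    case True
    then have "insert (x, y) F `` {u} = insert y (F `` {x})" by auto
    then show ?thesis using assms(2) fin by (simp add: card_insert_if)
  next
    case False
    then have "insert (x, y) F `` {u} = F `` {u}" by auto
    then show ?thesis using F by (simp add: degree_le_def)
  qed
  moreover have "card ((insert (x, y) F)\<inverse> `` {v}) \<le> k" for v
  proof (cases "v = y")
    case True
    then have "(insert (x, y) F)\<inverse> `` {v} = insert x (F\<inverse> `` {y})" by auto
    then show ?thesis using assms(3) fin by (simp add: card_insert_if)
  next
    case False
    then have "(insert (x, y) F)\<inverse> `` {v} = F\<inverse> `` {v}" by auto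
    then show ?thesis using F by (simp add: degree_le_def)
  qed
  ultimately show ?thesis using fin by (simp add: degree_le_def)
qed

lemma augment:
  assumes "degree_le k F" "F \<subseteq> E" "augmenting k E F m p q"
  shows "\<exists>F'. degree_le k F' \<and> F' \<subseteq> E \<and> card F' > card F"
  using assms
proof (induction m arbitrary: F p q rule: less_induct)
  \<comment> \<open>Exchanging the first two edges of the path between \<open>F\<close> and its complement preserves
    \<open>card F\<close> and shortens the path, provided that the path does not return to \<open>p 0\<close> or \<open>q 0\<close>.\<close>
  case (less m)
  have fin: "finite F" using less.prems by (simp add: degree_le_def)
  note aug = less.prems(3)[unfolded augmenting_def]
  consider i where "0 < i" "i \<le> m" "p i = p 0"
    | i where "0 < i" "i \<le> m" "q i = q 0"
    | "m = 0"
    | "0 < m" "\<forall>i. 0 < i \<and> i \<le> m \<longrightarrow> p i \<noteq> p 0 \<and> q i \<noteq> q 0"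
    by blast
  then show ?case
  proof cases
    case 1
    \<comment> \<open>The closed initial stretch is dropped; the new start equals \<open>p 0\<close>
      and so has spare degree.\<close>
    have "augmenting k E F (m - i) (\<lambda>j. p (i + j)) (\<lambda>j. q (i + j))"
      using aug 1 by (auto simp: augmenting_def)
    with less.IH[of "m - i"] less.prems 1 show ?thesis by auto
  next
    case 2
    \<comment> \<open>The edge \<open>(p 0, q 0)\<close> is also \<open>(p 0, q i)\<close>, so the
      walk can jump from \<open>p 0\<close> straight to \<open>q i\<close>; only index 0 of
      \<open>p\<close> needs patching.\<close>
    have "augmenting k E F (m - i) (\<lambda>j. if j = 0 then p 0 else p (i + j)) (\<lambda>j. q (i + j))"
      using aug 2 by (auto simp: augmenting_def)
    with less.IH[of "m - i"] less.prems 2 show ?thesis by auto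
  next
    case 3
    with aug have "(p 0, q 0) \<in> E - F" "card (F `` {p 0}) < k" "card (F\<inverse> `` {q 0}) < k" by auto
    then show ?thesis using degree_le_insert[OF less.prems(1)] less.prems(2) fin
      by (intro exI[of _ "insert (p 0, q 0) F"]) auto
  next
    case 4
    let ?x = "p 0" and ?y = "q 0" and ?x' = "p 1"
    let ?F = "insert (?x, ?y) (F - {(?x', ?y)})"
    have e: "(?x, ?y) \<in> E - F" "(?x', ?y) \<in> F" using aug 4 by auto
    then have ne: "?x' \<noteq> ?x" by auto
    have x: "?F `` {?x} = insert ?y (F `` {?x})" using ne by auto
    have x': "?F `` {?x'} = F `` {?x'} - {?y}" using ne by auto
    have y: "?F\<inverse> `` {?y} = insert ?x (F\<inverse> `` {?y} - {?x'})" by auto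
    have ox: "?F `` {u} = F `` {u}" if "u \<noteq> ?x" "u \<noteq> ?x'" for u using that by auto
    have oy: "?F\<inverse> `` {v} = F\<inverse> `` {v}" if "v \<noteq> ?y" for v using that by auto
    have fI: "finite (F `` {u})" "finite (F\<inverse> `` {v})" for u v
      using fin finite_Image by blast+
    have cy: "card (?F\<inverse> `` {v}) = card (F\<inverse> `` {v})" for v
    proof (cases "v = ?y")
      case True
      show ?thesis unfolding True y
        by (rule card_insert_remove1) (use e fI in auto)
    next
      case False
      then show ?thesis by (intro arg_cong[where f = card] oy)
    qed
    have d: "card (F `` {u}) \<le> k" "card (F\<inverse> `` {v}) \<le> k" for u v
      using less.prems(1) by (auto simp: degree_le_def)
    \<comment> \<open>Losing \<open>?y\<close> gives \<open>?x'\<close> spare degree whatever its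
      degree was, so the shortened walk may start there.\<close>
    have cx': "card (?F `` {?x'}) < k"
      unfolding x' using e(2) d(1)[of ?x'] fI(1)
      by (metis ImageI card_Diff1_less less_le_trans singletonI)
    have cx: "card (?F `` {u}) \<le> k" for u
    proof -
      consider "u = ?x" | "u = ?x'" | "u \<noteq> ?x" "u \<noteq> ?x'" by blast
      then show ?thesis
      proof cases
        case 1
        have "card (F `` {?x}) < k" using aug by blast
        then show ?thesis unfolding 1 x using fI(1) by (simp add: card_insert_if)
      next
        case 2
        then show ?thesis using cx' by simp
      next
        case 3
        then show ?thesis using d(1)[of u] ox by metis
      qed
    qed
    have "degree_le k ?F"
      unfolding degree_le_def using cx cy d(2) fin by simp
    moreover have "?F \<subseteq> E" using e less.prems(2) by auto
    moreover have "augmenting k E ?F (m - 1) (\<lambda>j. p (Suc j)) (\<lambda>j. q (Suc j))"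
      unfolding augmenting_def cy
    proof (intro conjI allI impI)
      fix i assume "i \<le> m - 1"
      then have i: "Suc i \<le> m" using 4 by simp
      then have "(p (Suc i), q (Suc i)) \<in> E - F" using aug by blast
      moreover have "p (Suc i) \<noteq> ?x" using 4(2) i by blast
      ultimately show "(p (Suc i), q (Suc i)) \<in> E - ?F" by auto
    next
      fix i assume "i < m - 1"
      then have "(p (Suc (Suc i)), q (Suc i)) \<in> F" "q (Suc i) \<noteq> ?y" using aug 4(2) by auto
      then show "(p (Suc (Suc i)), q (Suc i)) \<in> ?F" by auto
    next
      show "card (?F `` {p (Suc 0)}) < k" using cx' by simp
    next
      show "card (F\<inverse> `` {q (Suc (m - 1))}) < k" using aug 4(1) by simp
    qed
    moreover have "card ?F = card F"
      by (rule card_insert_remove1) (use e fin in auto)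
    ultimately show ?thesis using less.IH[of "m - 1" ?F] 4(1) by (metis diff_less zero_less_one)
  qed
qed

section \<open>From a maximum degree-bounded edge set to a deficient pair\<close>

lemma card_rel_eq_sum_Image:
  assumes "finite S" "finite F"
  shows "card (F \<inter> S \<times> UNIV) = (\<Sum>s\<in>S. card (F `` {s}))"
proof -
  have "F \<inter> S \<times> UNIV = Sigma S (\<lambda>s. F `` {s})" by auto
  then show ?thesis using assms by (simp add: card_SigmaI finite_Image)
qed

lemma card_rel_eq_sum_Image':
  assumes "finite T" "finite F"
  shows "card (F \<inter> UNIV \<times> T) = (\<Sum>t\<in>T. card (F\<inverse> `` {t}))"
proof -
  have "card (F \<inter> UNIV \<times> T) = card ((F \<inter> UNIV \<times> T)\<inverse>)" by simp
  also have "(F \<inter> UNIV \<times> T)\<inverse> = F\<inverse> \<inter> T \<times> UNIV" by auto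
  finally show ?thesis using card_rel_eq_sum_Image[of T "F\<inverse>"] assms by simp
qed

text \<open>Ore--Ryser theorem\<close>

lemma bipartite_factor_or_deficient_pair:
  fixes E :: "('a \<times> 'b) set"
  assumes "finite X" "finite Y" "E \<subseteq> X \<times> Y" "card X = card Y"
  obtains F where "F \<subseteq> E" "\<forall>x\<in>X. card (F `` {x}) = k" "\<forall>y\<in>Y. card (F\<inverse> `` {y}) = k"
  | S T where "S \<subseteq> X" "T \<subseteq> Y" "k * card S > card (E \<inter> S \<times> T) + k * card (Y - T)"
proof -
  have finE: "finite E" using assms by (meson finite_SigmaI finite_subset)
  let ?P = "\<lambda>F. degree_le k F \<and> F \<subseteq> E"
  have "?P {}" by (simp add: degree_le_def)
  moreover have "\<forall>F. ?P F \<longrightarrow> card F < Suc (card E)"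
    using finE by (simp add: card_mono less_Suc_eq_le)
  ultimately obtain F where F: "?P F" and max: "\<And>G. ?P G \<Longrightarrow> card G \<le> card F"
    using ex_has_greatest_nat[of ?P "{}" card "Suc (card E)"] by blast
  have no_aug: "\<not> augmenting k E F m p q" for m p q
    using augment[of k F E m p q] F max by (meson leD)
  have fin: "finite F" and d: "\<And>x. card (F `` {x}) \<le> k" "\<And>y. card (F\<inverse> `` {y}) \<le> k"
    using F by (auto simp: degree_le_def)
  have FXY: "F \<subseteq> X \<times> Y" using F assms by auto
  show ?thesis
  proof (cases "\<forall>x\<in>X. card (F `` {x}) = k")
    case True
    have "F \<inter> X \<times> UNIV = F \<inter> UNIV \<times> Y" using FXY by auto
    then have "(\<Sum>y\<in>Y. card (F\<inverse> `` {y})) = (\<Sum>x\<in>X. card (F `` {x}))"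
      using card_rel_eq_sum_Image[of X F] card_rel_eq_sum_Image'[of Y F] assms fin by simp
    also have "\<dots> = (\<Sum>y\<in>Y. k)" using True assms(4) by simp
    finally have "\<forall>y\<in>Y. card (F\<inverse> `` {y}) = k"
      using d(2) assms(2) sum_mono_inv[of "\<lambda>y. card (F\<inverse> `` {y})" Y "\<lambda>_. k"] by blast
    then show ?thesis using that(1) F True by blast
  next
    case False
    then obtain x0 where x0: "x0 \<in> X" "card (F `` {x0}) < k" using d(1) by (metis le_neq_implies_less)
    \<comment> \<open>One step of \<open>r\<close> is a non-\<open>F\<close> edge followed by an
      \<open>F\<close> edge. \<open>S\<close> is what such steps reach from vertices of spare
      degree, \<open>Q\<close> what one more non-\<open>F\<close> edge reaches; the deficient pair
      will be \<open>S\<close> and \<open>Y - Q\<close>.\<close>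
    define r where "r = {(x, x'). \<exists>y. (x, y) \<in> E - F \<and> (x', y) \<in> F}"
    define S where "S = {x \<in> X. \<exists>u. card (F `` {u}) < k \<and> (u, x) \<in> r\<^sup>*}"
    define Q where "Q = (E - F) `` S"
    have SX: "S \<subseteq> X" and QY: "Q \<subseteq> Y" using assms(3) by (auto simp: S_def Q_def)
    have finS: "finite S" and finQ: "finite Q" using SX QY assms finite_subset by blast+
    have degQ: "card (F\<inverse> `` {y}) = k" if yQ: "y \<in> Q" for y
    proof (rule ccontr)
      assume "card (F\<inverse> `` {y}) \<noteq> k"
      then have y: "card (F\<inverse> `` {y}) < k" using d(2) le_neq_implies_less by blast
      obtain x u where x: "(x, y) \<in> E - F" and u: "card (F `` {u}) < k" "(u, x) \<in> r\<^sup>*"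
        using yQ by (auto simp: Q_def S_def)
      obtain m where "(u, x) \<in> r ^^ m" using u(2) rtrancl_imp_relpow by blast
      then obtain p where p: "p 0 = u" "p m = x" "\<forall>i<m. (p i, p (Suc i)) \<in> r"
        unfolding relpow_fun_conv by blast
      then have "\<forall>i. \<exists>y'. i < m \<longrightarrow> (p i, y') \<in> E - F \<and> (p (Suc i), y') \<in> F"
        unfolding r_def by blast
      then obtain q where q: "\<forall>i. i < m \<longrightarrow> (p i, q i) \<in> E - F \<and> (p (Suc i), q i) \<in> F"
        by metis
      have "augmenting k E F m p (q(m := y))"
        unfolding augmenting_def using p q x y u(1) by (auto simp: le_less)
      with no_aug show False by blast
    qed
    have nbrQ: "x \<in> S" if xy: "(x, y) \<in> F" and y: "y \<in> Q" for x y
    proof -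
      obtain x' u where "(x', y) \<in> E - F" "card (F `` {u}) < k" "(u, x') \<in> r\<^sup>*"
        using y by (auto simp: Q_def S_def)
      moreover from this xy have "(x', x) \<in> r" unfolding r_def by blast
      ultimately have "(u, x) \<in> r\<^sup>*" by (meson rtrancl.rtrancl_into_rtrancl)
      then show ?thesis using \<open>card (F `` {u}) < k\<close> xy FXY unfolding S_def by blast
    qed
    have "x0 \<in> S" using x0 by (auto simp: S_def)
    have "(\<Sum>s\<in>S. card (F `` {s})) < (\<Sum>s\<in>S. k)"
      using finS d(1) x0(2) \<open>x0 \<in> S\<close> by (intro sum_strict_mono_ex1) auto
    then have "card (F \<inter> S \<times> UNIV) < k * card S"
      using card_rel_eq_sum_Image[OF finS fin] by (simp add: mult.commute)
    \<comment> \<open>Non-\<open>F\<close> edges from \<open>S\<close> end in \<open>Q\<close>, so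
      towards \<open>Y - Q\<close> the edges of \<open>E\<close> and of \<open>F\<close> at
      \<open>S\<close> coincide; by \<open>nbrQ\<close> all \<open>F\<close>-edges at
      \<open>Q\<close> start in \<open>S\<close>.\<close>
    moreover have "F \<inter> S \<times> UNIV = (E \<inter> S \<times> (Y - Q)) \<union> (F \<inter> UNIV \<times> Q)"
      using nbrQ FXY F assms(3) unfolding Q_def by blast
    moreover have "card ((E \<inter> S \<times> (Y - Q)) \<union> (F \<inter> UNIV \<times> Q))
        = card (E \<inter> S \<times> (Y - Q)) + card (F \<inter> UNIV \<times> Q)"
      by (rule card_Un_disjoint) (use finE fin in auto)
    moreover have "card (F \<inter> UNIV \<times> Q) = k * card Q"
      using card_rel_eq_sum_Image'[OF finQ fin] degQ by (simp add: mult.commute)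
    moreover have "Y - (Y - Q) = Q" using QY by blast
    ultimately show ?thesis using that(2)[of S "Y - Q"] SX by simp
  qed
qed

text \<open>Deleting a vertex from one of the two sets changes the deficiency \<open>D\<close> by
  its degree into the other set minus \<open>k\<close>; inserting one changes it by \<open>k\<close>
  minus that degree. Optimality, with ties broken towards small sets, turns this into the four
  degree bounds. Positivity of \<open>D\<close> gives the two cardinality bounds.\<close>

lemma extremal_deficient_pair:
  fixes E :: "('a \<times> 'b) set"
  assumes fin: "finite X" "finite Y" and E: "E \<subseteq> X \<times> Y" and XY: "card X = card Y"
    and S0: "S0 \<subseteq> X" "T0 \<subseteq> Y" "k * card S0 > card (E \<inter> S0 \<times> T0) + k * card (Y - T0)"
  obtains S T where "S \<subseteq> X" "T \<subseteq> Y" "card S > card (Y - T)" "card T > card (X - S)"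
    "\<forall>s\<in>S. card (E `` {s} \<inter> T) < k" "\<forall>t\<in>T. card (E\<inverse> `` {t} \<inter> S) < k"
    "\<forall>p\<in>X - S. k \<le> card (E `` {p} \<inter> T)" "\<forall>q\<in>Y - T. k \<le> card (E\<inverse> `` {q} \<inter> S)"
proof -
  have finE: "finite E" using fin E by (meson finite_SigmaI finite_subset)
  define n where "n = int (card X)"
  define D where "D = (\<lambda>(S, T). int k * (int (card S) + int (card T) - n) - int (card (E \<inter> S \<times> T)))"
  \<comment> \<open>maximise the deficiency \<open>D\<close> first, then minimise \<open>card S + card T\<close>\<close>
  define f where "f = (\<lambda>(S, T). (2 * n + 1) * D (S, T) - int (card S) - int (card T))"
  let ?C = "Pow X \<times> Pow Y"
  have finC: "finite (f ` ?C)" using fin by simp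
  have "f ` ?C \<noteq> {}" using S0 by blast
  then have "Max (f ` ?C) \<in> f ` ?C" by (rule Max_in[OF finC])
  then have "\<exists>P\<in>?C. Max (f ` ?C) = f P" unfolding image_iff .
  then obtain P where P: "P \<in> ?C" "f P = Max (f ` ?C)" by force
  then have max0: "f P' \<le> f P" if "P' \<in> ?C" for P' using Max_ge[OF finC] that by simp
  obtain S T where "P = (S, T)" by force
  with P max0 have S: "S \<subseteq> X" "T \<subseteq> Y" and max: "\<And>S' T'. S' \<subseteq> X \<Longrightarrow> T' \<subseteq> Y \<Longrightarrow> f (S', T') \<le> f (S, T)"
    by auto
  have finST: "finite S" "finite T" using S fin finite_subset by blast+
  have cle: "card S' \<le> card X" "card T' \<le> card X" if "S' \<subseteq> X" "T' \<subseteq> Y" for S' T'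
    using that fin XY card_mono[of X S'] card_mono[of Y T'] by simp_all
  have D0: "D (S0, T0) \<ge> 1"
  proof -
    have "card (Y - T0) = card Y - card T0" "card T0 \<le> card Y"
      using S0(2) fin by (auto simp: card_Diff_subset finite_subset card_mono)
    then have eq: "int (card (Y - T0)) = n - int (card T0)" using XY by (simp add: n_def)
    have "int k * (int (card S0) + int (card T0) - n) = int k * int (card S0) - int k * int (card (Y - T0))"
      unfolding eq by (simp add: algebra_simps)
    moreover have "int k * int (card S0) > int (card (E \<inter> S0 \<times> T0)) + int k * int (card (Y - T0))"
      using S0(3) by (metis of_nat_add of_nat_less_iff of_nat_mult)
    ultimately show ?thesis unfolding D_def by simp
  qed
  \<comment> \<open>The tie-breaking terms sum to at most \<open>2 * n\<close>, so the weight
    \<open>2 * n + 1\<close> makes \<open>f\<close> positive at \<open>(S0, T0)\<close>, whereas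
    \<open>D (S, T) \<le> 0\<close> would force \<open>f (S, T) \<le> 0\<close>.\<close>
  have "D (S, T) > 0"
  proof (rule ccontr)
    assume "\<not> D (S, T) > 0"
    then have "(2 * n + 1) * D (S, T) \<le> 0" by (intro mult_nonneg_nonpos) (auto simp: n_def)
    then have "f (S, T) \<le> 0" by (simp add: f_def)
    moreover define c where "c = (2 * n + 1) * D (S0, T0)"
    have "(2 * n + 1) * 1 \<le> c"
      unfolding c_def using D0 by (intro mult_left_mono) (auto simp: n_def)
    moreover have "int (card S0) \<le> n" "int (card T0) \<le> n"
      using cle[OF S0(1,2)] by (simp_all add: n_def)
    ultimately have "f (S, T) < f (S0, T0)" by (simp add: f_def c_def[symmetric])
    then show False using max[OF S0(1,2)] by simp
  qed
  then have "int k * (int (card S) + int (card T) - n) > 0" by (simp add: D_def)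
  then have ST: "int (card S) + int (card T) > n" by (simp add: zero_less_mult_iff)
  have "card (Y - T) = card Y - card T" "card (X - S) = card X - card S"
    using S fin by (auto simp: card_Diff_subset finite_subset)
  then have less: "card S > card (Y - T)" "card T > card (X - S)"
    using ST XY cle[OF S] by (auto simp: n_def)
  have eS: "int (card (E \<inter> insert s S \<times> T)) = int (card (E \<inter> S \<times> T)) + int (card (E `` {s} \<inter> T))"
    if "s \<notin> S" for s S T
  proof -
    have "E \<inter> insert s S \<times> T = (E \<inter> S \<times> T) \<union> Pair s ` (E `` {s} \<inter> T)" by auto
    moreover have "card (Pair s ` (E `` {s} \<inter> T)) = card (E `` {s} \<inter> T)"
      by (rule card_image) (auto simp: inj_on_def)
    moreover have "card ((E \<inter> S \<times> T) \<union> Pair s ` (E `` {s} \<inter> T))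
        = card (E \<inter> S \<times> T) + card (Pair s ` (E `` {s} \<inter> T))"
      by (rule card_Un_disjoint) (use that finE finite_Image in auto)
    ultimately show ?thesis by simp
  qed
  have eT: "int (card (E \<inter> S \<times> insert t T)) = int (card (E \<inter> S \<times> T)) + int (card (E\<inverse> `` {t} \<inter> S))"
    if "t \<notin> T" for t S T
  proof -
    have "E \<inter> S \<times> insert t T = (E \<inter> S \<times> T) \<union> (\<lambda>s. (s, t)) ` (E\<inverse> `` {t} \<inter> S)" by auto
    moreover have "card ((\<lambda>s. (s, t)) ` (E\<inverse> `` {t} \<inter> S)) = card (E\<inverse> `` {t} \<inter> S)"
      by (rule card_image) (auto simp: inj_on_def)
    moreover have "card ((E \<inter> S \<times> T) \<union> (\<lambda>s. (s, t)) ` (E\<inverse> `` {t} \<inter> S))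
        = card (E \<inter> S \<times> T) + card ((\<lambda>s. (s, t)) ` (E\<inverse> `` {t} \<inter> S))"
      by (rule card_Un_disjoint) (use that finE finite_Image finite_converse in auto)
    ultimately show ?thesis by simp
  qed
  have n1: "n \<ge> 1"
  proof -
    have "0 < card S" using less by simp
    then show ?thesis using cle(1)[OF S] by (simp add: n_def)
  qed
  \<comment> \<open>The \<open>+ 1\<close> gained by deleting a vertex makes this bound strict,
    while the \<open>- 1\<close> paid for inserting one in \<open>add\<close> is too small to offset
    a whole unit of \<open>D\<close>.\<close>
  have rem: "a < int k" if "f Q \<le> f (S, T)" "f Q = f (S, T) + (2 * n + 1) * (a - int k) + 1" for Q a
  proof (rule ccontr)
    assume "\<not> a < int k"
    then have "(2 * n + 1) * (a - int k) \<ge> 0" using n1 by simp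
    with that show False by linarith
  qed
  have add: "int k \<le> a" if "f Q \<le> f (S, T)" "f Q = f (S, T) + (2 * n + 1) * (int k - a) - 1" for Q a
  proof (rule ccontr)
    assume "\<not> int k \<le> a"
    define c where "c = (2 * n + 1) * (int k - a)"
    have "(2 * n + 1) * 1 \<le> c" unfolding c_def
      using n1 \<open>\<not> int k \<le> a\<close> by (intro mult_left_mono) auto
    with that[folded c_def] n1 show False by simp
  qed
  have "card (E `` {s} \<inter> T) < k" if s: "s \<in> S" for s
  proof -
    have "int (card S) = int (card (S - {s})) + 1"
      using card_Suc_Diff1[OF finST(1) s] by linarith
    moreover have "f (S - {s}, T) \<le> f (S, T)" by (rule max) (use S in auto)
    moreover have "int (card (E \<inter> S \<times> T)) = int (card (E \<inter> (S - {s}) \<times> T)) + int (card (E `` {s} \<inter> T))"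
      using eS[of s "S - {s}" T] s by (simp add: insert_absorb)
    ultimately have "int (card (E `` {s} \<inter> T)) < int k"
      by (intro rem[of "(S - {s}, T)"]) (auto simp: f_def D_def algebra_simps)
    then show ?thesis by simp
  qed
  moreover have "card (E\<inverse> `` {t} \<inter> S) < k" if t: "t \<in> T" for t
  proof -
    have "int (card T) = int (card (T - {t})) + 1"
      using card_Suc_Diff1[OF finST(2) t] by linarith
    moreover have "f (S, T - {t}) \<le> f (S, T)" by (rule max) (use S in auto)
    moreover have "int (card (E \<inter> S \<times> T)) = int (card (E \<inter> S \<times> (T - {t}))) + int (card (E\<inverse> `` {t} \<inter> S))"
      using eT[of t "T - {t}" S] t by (simp add: insert_absorb)
    ultimately have "int (card (E\<inverse> `` {t} \<inter> S)) < int k"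
      by (intro rem[of "(S, T - {t})"]) (auto simp: f_def D_def algebra_simps)
    then show ?thesis by simp
  qed
  moreover have "k \<le> card (E `` {p} \<inter> T)" if p: "p \<in> X - S" for p
  proof -
    have "int (card (insert p S)) = int (card S) + 1" using p finST(1) by simp
    moreover have "f (insert p S, T) \<le> f (S, T)" by (rule max) (use S p in auto)
    ultimately have "int k \<le> int (card (E `` {p} \<inter> T))"
      using eS[of p S T] p by (intro add[of "(insert p S, T)"]) (auto simp: f_def D_def algebra_simps)
    then show ?thesis by simp
  qed
  moreover have "k \<le> card (E\<inverse> `` {q} \<inter> S)" if q: "q \<in> Y - T" for q
  proof -
    have "int (card (insert q T)) = int (card T) + 1" using q finST(2) by simp
    moreover have "f (S, insert q T) \<le> f (S, T)" by (rule max) (use S q in auto)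
    ultimately have "int k \<le> int (card (E\<inverse> `` {q} \<inter> S))"
      using eT[of q T S] q by (intro add[of "(S, insert q T)"]) (auto simp: f_def D_def algebra_simps)
    then show ?thesis by simp
  qed
  ultimately show ?thesis by (intro that[OF S less] ballI)
qed

section \<open>Existence of a regular factor\<close>

text \<open>A union bound. It is used to select leaves at one centre that avoid all neighbours of
  the \<open>k\<close> leaves chosen at the other.\<close>

lemma card_le_card_diff_Image:
  assumes "finite A" "card A \<le> k" "finite B" "\<And>a. a \<in> A \<Longrightarrow> card (E `` {a} \<inter> B) \<le> j"
  shows "card B \<le> card (B - E `` A) + k * j"
proof -
  have "E `` A \<inter> B = (\<Union>a\<in>A. E `` {a} \<inter> B)" by auto
  then have "card (E `` A \<inter> B) \<le> (\<Sum>a\<in>A. card (E `` {a} \<inter> B))"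
    using card_UN_le[OF assms(1)] by metis
  also have "\<dots> \<le> card A * j" using sum_bounded_above[of A "\<lambda>a. card (E `` {a} \<inter> B)" j] assms(4) by simp
  also have "\<dots> \<le> k * j" using assms(2) by simp
  finally have "card (E `` A \<inter> B) \<le> k * j" .
  moreover have "B = (B - E `` A) \<union> (E `` A \<inter> B)" by auto
  then have "card B \<le> card (B - E `` A) + card (E `` A \<inter> B)" by (metis card_Un_le)
  ultimately show ?thesis by simp
qed

text \<open>Both orientations of every edge are kept, so the two parts can be interchanged and an
  edge can be read from either end.\<close>

locale bipartite_relation =
  fixes E :: "'a rel" and X Y :: "'a set"
  assumes finite_parts: "finite X" "finite Y"
    and disjoint: "X \<inter> Y = {}"
    and arcs: "E \<subseteq> X \<times> Y \<union> Y \<times> X"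
    and sym: "sym E"
begin

lemma finite_arcs: "finite E"
  using arcs finite_parts by (meson finite_SigmaI finite_UnI finite_subset)

lemma finite_nbrs: "finite (E `` A)"
  using finite_arcs by (rule finite_Image)

lemma nbrs_X: "x \<in> X \<Longrightarrow> E `` {x} \<subseteq> Y" and nbrs_Y: "y \<in> Y \<Longrightarrow> E `` {y} \<subseteq> X"
  using arcs disjoint by auto

lemma commute: "(x, y) \<in> E \<longleftrightarrow> (y, x) \<in> E"
  using sym by (auto dest: symD)

end

locale double_star_free_relation = bipartite_relation +
  fixes k l :: nat
  assumes kl: "2 \<le> k" "k \<le> l"
    and no_double_star: "\<lbrakk>(x, y) \<in> E; A \<subseteq> E `` {x} - {y}; B \<subseteq> E `` {y} - {x}; card A = k; card B = l\<rbrakk>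
      \<Longrightarrow> E \<inter> A \<times> B \<noteq> {}"
begin

lemma no_large_double_star:
  assumes "(x, y) \<in> E" "A \<subseteq> E `` {x} - {y}" "B \<subseteq> E `` {y} - {x}" "k \<le> card A" "l \<le> card B"
  shows "E \<inter> A \<times> B \<noteq> {}"
proof -
  obtain A' B' where "A' \<subseteq> A" "card A' = k" "B' \<subseteq> B" "card B' = l"
    using assms(4,5) by (meson obtain_subset_with_card_n)
  then show ?thesis using no_double_star[OF assms(1), of A' B'] assms(2,3) by blast
qed

text \<open>A deficient pair is refuted by splitting \<open>Y - T\<close> into \<open>Q1\<close>,
  \<open>Q2\<close> (few or many neighbours in \<open>S\<close>) and \<open>S\<close> into
  \<open>S1\<close>, \<open>S2\<close> (some or no neighbours in \<open>Q1\<close>). Most of the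
  missing adjacencies follow because an edge there would join the centres of a forbidden double
  star.\<close>

lemma regular_factor_exists:
  assumes XY: "card X = card Y"
    and deg: "\<And>v. v \<in> X \<union> Y \<Longrightarrow> 2 * (k * (k - 1) + l) \<le> card (E `` {v})"
    and conn: "\<And>C. C \<subseteq> X \<union> Y \<Longrightarrow> C \<noteq> {} \<Longrightarrow> E `` C \<subseteq> C \<Longrightarrow> C = X \<union> Y"
  obtains F where "F \<subseteq> E" "sym F" "\<forall>v\<in>X \<union> Y. card (F `` {v}) = k"
proof -
  let ?E = "E \<inter> X \<times> Y"
  have EX: "?E `` {x} = E `` {x}" if "x \<in> X" for x using nbrs_X[OF that] that by auto
  have EY: "?E\<inverse> `` {y} = E `` {y}" if "y \<in> Y" for y using nbrs_Y[OF that] that commute by auto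
  note fin = finite_parts
  show ?thesis
  proof (rule bipartite_factor_or_deficient_pair[of X Y ?E k])
    show "finite X" "finite Y" "?E \<subseteq> X \<times> Y" "card X = card Y" using fin XY by auto
  next
    fix F assume F: "F \<subseteq> ?E" "\<forall>x\<in>X. card (F `` {x}) = k" "\<forall>y\<in>Y. card (F\<inverse> `` {y}) = k"
    have "(F \<union> F\<inverse>) `` {x} = F `` {x}" if "x \<in> X" for x using that F(1) disjoint by auto
    moreover have "(F \<union> F\<inverse>) `` {y} = F\<inverse> `` {y}" if "y \<in> Y" for y using that F(1) disjoint by auto
    ultimately have "\<forall>v\<in>X \<union> Y. card ((F \<union> F\<inverse>) `` {v}) = k" using F by auto
    moreover have "F \<union> F\<inverse> \<subseteq> E" using F(1) commute by auto
    ultimately show ?thesis using that[of "F \<union> F\<inverse>"] by (simp add: sym_Un_converse)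
  next
    fix S0 T0 assume "S0 \<subseteq> X" "T0 \<subseteq> Y" "card (?E \<inter> S0 \<times> T0) + k * card (Y - T0) < k * card S0"
    then obtain S T where ST: "S \<subseteq> X" "T \<subseteq> Y" and less: "card S > card (Y - T)" "card T > card (X - S)"
      and degs: "\<forall>s\<in>S. card (?E `` {s} \<inter> T) < k" "\<forall>t\<in>T. card (?E\<inverse> `` {t} \<inter> S) < k"
      "\<forall>p\<in>X - S. k \<le> card (?E `` {p} \<inter> T)" "\<forall>q\<in>Y - T. k \<le> card (?E\<inverse> `` {q} \<inter> S)"
      using extremal_deficient_pair[OF fin Int_lower2 XY] by metis
    define P Q where "P = X - S" and "Q = Y - T"
    \<comment> \<open>Among \<open>d\<close> neighbours, up to \<open>k * (k - 1)\<close> may be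
      lost to \<open>k\<close> vertices having at most \<open>k - 1\<close> neighbours each, and
      \<open>l\<close> leaves still remain. With degree at least \<open>2 * d\<close>, a vertex of
      \<open>Q\<close> has \<open>d\<close> neighbours in \<open>S\<close> or \<open>d\<close> in
      \<open>P\<close>.\<close>
    define d where "d = k * (k - 1) + l"
    have deg: "2 * d \<le> card (E `` {v})" if "v \<in> X \<union> Y" for v
      using deg[OF that] by (simp add: d_def)
    let ?deg = "\<lambda>v W. card (E `` {v} \<inter> W)"
    have sT: "?deg s T < k" if "s \<in> S" for s using degs(1) that ST EX by (metis subsetD)
    have tS: "?deg t S < k" if "t \<in> T" for t using degs(2) that ST EY by (metis subsetD)
    have pT: "k \<le> ?deg p T" if "p \<in> P" for p using degs(3) that EX unfolding P_def by (metis DiffD1)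
    have parts: "P \<subseteq> X" "Q \<subseteq> Y" "S \<inter> P = {}" "T \<inter> Q = {}" "X = S \<union> P" "Y = T \<union> Q"
      using ST by (auto simp: P_def Q_def)
    have finST: "finite S" "finite T" "finite P" "finite Q" using parts ST fin finite_subset by blast+
    have kk: "2 * k - 2 \<le> d" "k \<le> d" "l \<le> d" "2 \<le> k" "k \<le> l"
    proof -
      have "2 * (k - 1) \<le> k * (k - 1)" using kl by (intro mult_le_mono1)
      then have "2 * (k - 1) + l \<le> d" unfolding d_def by simp
      then show "2 * k - 2 \<le> d" "k \<le> d" "l \<le> d" "2 \<le> k" "k \<le> l" using kl by auto
    qed
    have split: "card (E `` {v}) = ?deg v W1 + ?deg v W2"
      if "E `` {v} \<subseteq> W1 \<union> W2" "W1 \<inter> W2 = {}" for v W1 W2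
    proof -
      have "E `` {v} = (E `` {v} \<inter> W1) \<union> (E `` {v} \<inter> W2)" using that by auto
      moreover have "(E `` {v} \<inter> W1) \<inter> (E `` {v} \<inter> W2) = {}" using that by auto
      ultimately show ?thesis using finite_nbrs by (metis card_Un_disjoint finite_Int)
    qed
    have star: False if "(x, y) \<in> E" "A \<subseteq> E `` {x} - {y}" "B \<subseteq> E `` {y} - {x}" "k \<le> card A" "l \<le> card B"
      "E \<inter> A \<times> B = {}" for x y A B
      using no_large_double_star that by blast
    define Q2 where "Q2 = {q \<in> Q. d \<le> ?deg q S}"
    define Q1 where "Q1 = Q - Q2"
    have Q2P: "(q, p) \<notin> E" if q: "q \<in> Q2" and p: "p \<in> P" for q p
    proof
      assume qp: "(q, p) \<in> E"
      obtain A where A: "A \<subseteq> E `` {p} \<inter> T" "card A = k"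
        using pT[OF p] by (meson obtain_subset_with_card_n)
      let ?B = "E `` {q} \<inter> S"
      have "card (E `` {a} \<inter> ?B) \<le> k - 1" if "a \<in> A" for a
      proof -
        have "card (E `` {a} \<inter> ?B) \<le> ?deg a S" using finST by (intro card_mono) auto
        then show ?thesis using tS[of a] that A by fastforce
      qed
      then have "card ?B \<le> card (?B - E `` A) + k * (k - 1)"
        using A finST finite_subset by (intro card_le_card_diff_Image) auto
      then have B: "l \<le> card (?B - E `` A)" using q unfolding Q2_def d_def by simp
      show False
      proof (rule star[OF _ _ _ _ B])
        show "(p, q) \<in> E" using qp commute by blast
        show "k \<le> card A" using A by simp
        show "A \<subseteq> E `` {p} - {q}" "?B - E `` A \<subseteq> E `` {q} - {p}"
          using A parts p q unfolding Q2_def by auto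
        show "E \<inter> A \<times> (?B - E `` A) = {}" by auto
      qed
    qed
    have Q1S: "?deg q S < d" if "q \<in> Q1" for q using that by (auto simp: Q1_def Q2_def)
    have Q12: "Q = Q1 \<union> Q2" "Q1 \<inter> Q2 = {}" by (auto simp: Q1_def Q2_def)
    have Q1P: "d \<le> ?deg q P" if "q \<in> Q1" for q
    proof -
      have "q \<in> Y" using that Q12 parts by auto
      then have "card (E `` {q}) = ?deg q S + ?deg q P" "2 * d \<le> card (E `` {q})"
        using nbrs_Y[of q] parts deg[of q] by (auto intro!: split)
      then show ?thesis using Q1S[OF that] by linarith
    qed
    have SQ: "2 * d \<le> ?deg s Q + (k - 1)" if "s \<in> S" for s
    proof -
      have "s \<in> X" using that parts by auto
      then have "card (E `` {s}) = ?deg s T + ?deg s Q" "2 * d \<le> card (E `` {s})"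
        using nbrs_X[of s] parts deg[of s] by (auto intro!: split)
      then show ?thesis using sT[OF that] by linarith
    qed
    have TP: "2 * d \<le> ?deg t P + (k - 1)" if "t \<in> T" for t
    proof -
      have "t \<in> Y" using that parts by auto
      then have "card (E `` {t}) = ?deg t S + ?deg t P" "2 * d \<le> card (E `` {t})"
        using nbrs_Y[of t] parts deg[of t] by (auto intro!: split)
      then show ?thesis using tS[OF that] by linarith
    qed
    have SQ': "?deg s Q = ?deg s Q1 + ?deg s Q2" for s
    proof -
      have "E `` {s} \<inter> Q = (E `` {s} \<inter> Q1) \<union> (E `` {s} \<inter> Q2)" using Q12 by auto
      moreover have "(E `` {s} \<inter> Q1) \<inter> (E `` {s} \<inter> Q2) = {}" using Q12 by auto
      ultimately show ?thesis using finite_nbrs by (metis card_Un_disjoint finite_Int)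
    qed
    define S1 where "S1 = {s \<in> S. E `` {s} \<inter> Q1 \<noteq> {}}"
    define S2 where "S2 = S - S1"
    \<comment> \<open>By \<open>Q2P\<close>, \<open>k\<close> neighbours of \<open>s\<close> in
      \<open>Q2\<close> and the neighbours in \<open>P\<close> of some \<open>q\<close> in
      \<open>Q1\<close> adjacent to \<open>s\<close> would form a double star.\<close>
    have S1Q2: "?deg s Q2 < k" if s: "s \<in> S1" for s
    proof (rule ccontr)
      assume "\<not> ?deg s Q2 < k"
      then have A: "k \<le> card (E `` {s} \<inter> Q2)" by simp
      obtain q where q: "(s, q) \<in> E" "q \<in> Q1" using s by (auto simp: S1_def)
      show False
      proof (rule star[OF q(1) _ _ A])
        show "l \<le> card (E `` {q} \<inter> P)" using Q1P[OF q(2)] kk by simp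
        show "E `` {s} \<inter> Q2 \<subseteq> E `` {s} - {q}" "E `` {q} \<inter> P \<subseteq> E `` {q} - {s}"
          using Q12 q s parts by (auto simp: S1_def)
        show "E \<inter> (E `` {s} \<inter> Q2) \<times> (E `` {q} \<inter> P) = {}" using Q2P by auto
      qed
    qed
    have S1Q1: "2 * d \<le> ?deg s Q1 + (2 * k - 2)" if "s \<in> S1" for s
      using SQ[of s] SQ'[of s] S1Q2[OF that] that kk unfolding S1_def by auto
    have S1Q1k: "d \<le> ?deg s Q1" if "s \<in> S1" for s
      using S1Q1[OF that] kk by linarith
    have finS12: "finite S1" "finite Q1" "finite Q2" "finite S2"
      using finST by (auto simp: S1_def S2_def Q1_def Q2_def)
    \<comment> \<open>Double count of the edges between \<open>S1\<close> and \<open>Q1\<close>: at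
      least \<open>d\<close> at each vertex of \<open>S1\<close>, fewer than \<open>d\<close> at
      each vertex of \<open>Q1\<close>. Since \<open>card Q < card S\<close>, \<open>S1\<close>
      cannot exhaust \<open>S\<close>.\<close>
    have "d * card S1 \<le> d * card Q1"
    proof -
      have "d * card S1 = (\<Sum>s\<in>S1. d)" by simp
      also have "\<dots> \<le> (\<Sum>s\<in>S1. card {q \<in> Q1. (s, q) \<in> E})"
      proof (rule sum_mono)
        fix s assume "s \<in> S1"
        moreover have "E `` {s} \<inter> Q1 = {q \<in> Q1. (s, q) \<in> E}" by auto
        ultimately show "d \<le> card {q \<in> Q1. (s, q) \<in> E}" using S1Q1k by metis
      qed
      also have "\<dots> = (\<Sum>q\<in>Q1. card {s \<in> S1. (s, q) \<in> E})"
        by (rule sum_multicount_gen) (use finS12 in auto)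
      also have "\<dots> \<le> (\<Sum>q\<in>Q1. d)"
      proof (rule sum_mono)
        fix q assume q: "q \<in> Q1"
        have "card {s \<in> S1. (s, q) \<in> E} \<le> ?deg q S"
          using finST commute by (intro card_mono) (auto simp: S1_def)
        then show "card {s \<in> S1. (s, q) \<in> E} \<le> d" using Q1S[OF q] by linarith
      qed
      finally show ?thesis by simp
    qed
    then have "card S1 \<le> card Q1" using kk by simp
    also have "\<dots> \<le> card Q" using Q12 finST by (intro card_mono) auto
    also have "\<dots> < card S" using less by (simp add: Q_def)
    finally have "S2 \<noteq> {}" unfolding S2_def S1_def by (metis (lifting) Diff_eq_empty_iff finS12(1) S1_def card_mono leD)
    have S2Q1: "(s, q) \<notin> E" if "s \<in> S2" "q \<in> Q1" for s q
      using that by (auto simp: S2_def S1_def)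
    have S2T: "(s, t) \<notin> E" if s: "s \<in> S2" and t: "t \<in> T" for s t
    proof
      assume st: "(s, t) \<in> E"
      have "E `` {s} \<inter> Q1 = {}" using S2Q1[OF s] by auto
      then have "?deg s Q1 = 0" by simp
      then have "k \<le> ?deg s Q2" using SQ[of s] SQ'[of s] s kk by (simp add: S2_def)
      show False
      proof (rule star[OF st _ _ \<open>k \<le> ?deg s Q2\<close>])
        show "l \<le> card (E `` {t} \<inter> P)" using TP[OF t] kk by simp
        show "E `` {s} \<inter> Q2 \<subseteq> E `` {s} - {t}" "E `` {t} \<inter> P \<subseteq> E `` {t} - {s}"
          using Q12 s t parts by (auto simp: S2_def)
        show "E \<inter> (E `` {s} \<inter> Q2) \<times> (E `` {t} \<inter> P) = {}" using Q2P by auto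
      qed
    qed
    have S2nbrs: "E `` {s} \<subseteq> Q2" if "s \<in> S2" for s
      using nbrs_X[of s] parts Q12 S2T S2Q1 that by (auto simp: S2_def)
    define R where "R = {q \<in> Q2. E `` {q} \<inter> S1 \<noteq> {}}"
    have Q2nbrs: "E `` {q} \<subseteq> S1 \<union> S2" if "q \<in> Q2" for q
      using nbrs_Y[of q] parts Q12 Q2P that by (auto simp: S2_def S1_def)
    have RS2: "?deg q S2 < l" if q: "q \<in> R" for q
    proof (rule ccontr)
      assume "\<not> ?deg q S2 < l"
      then have B: "l \<le> card (E `` {q} \<inter> S2)" by simp
      obtain s where s: "(q, s) \<in> E" "s \<in> S1" using q by (auto simp: R_def)
      show False
      proof (rule star[OF _ _ _ _ B])
        show "(s, q) \<in> E" using s commute by blast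
        show "k \<le> card (E `` {s} \<inter> Q1)" using S1Q1k[OF s(2)] kk by linarith
        show "E `` {s} \<inter> Q1 \<subseteq> E `` {s} - {q}" "E `` {q} \<inter> S2 \<subseteq> E `` {q} - {s}"
          using Q12 q s by (auto simp: S2_def R_def)
        show "E \<inter> (E `` {s} \<inter> Q1) \<times> (E `` {q} \<inter> S2) = {}" using S2Q1 commute by auto
      qed
    qed
    \<comment> \<open>Fewer than \<open>l\<close> neighbours in \<open>S2\<close> leave
      \<open>q\<close> at least \<open>k\<close> in \<open>S1\<close>. Each of those has fewer than
      \<open>k\<close> neighbours in \<open>Q2\<close>, which contains all neighbours of
      \<open>s\<close>, so at least \<open>l\<close> neighbours of \<open>s\<close> avoid
      them.\<close>
    have RS2': "(q, s) \<notin> E" if q: "q \<in> R" and s: "s \<in> S2" for q s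
    proof
      assume qs: "(q, s) \<in> E"
      have qY: "q \<in> Y" using q Q12 parts by (auto simp: R_def)
      have "card (E `` {q}) = ?deg q S1 + ?deg q S2"
        using Q2nbrs q by (intro split) (auto simp: R_def S2_def)
      then have "k \<le> ?deg q S1" using RS2[OF q] deg[of q] qY kk by auto
      then obtain A where A: "A \<subseteq> E `` {q} \<inter> S1" "card A = k" by (meson obtain_subset_with_card_n)
      let ?B = "E `` {s}"
      have "card (E `` {a} \<inter> ?B) \<le> k - 1" if "a \<in> A" for a
      proof -
        have "card (E `` {a} \<inter> ?B) \<le> ?deg a Q2"
          using finite_nbrs S2nbrs[OF s] by (intro card_mono) auto
        then show ?thesis using S1Q2[of a] that A by fastforce
      qed
      then have "card ?B \<le> card (?B - E `` A) + k * (k - 1)"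
        using A finite_nbrs finS12 finite_subset by (intro card_le_card_diff_Image) auto
      then have B: "l \<le> card (?B - E `` A)" using deg[of s] s parts by (auto simp: S2_def d_def)
      have "q \<in> E `` A" using A(1,2) kk commute by (metis (no_types, lifting) Image_iff IntD1 Image_singleton_iff card.empty ex_in_conv not_numeral_le_zero subsetD)
      show False
      proof (rule star[OF qs _ _ _ B])
        show "k \<le> card A" using A by simp
        show "A \<subseteq> E `` {q} - {s}" "?B - E `` A \<subseteq> E `` {s} - {q}"
          using A s \<open>q \<in> E `` A\<close> by (auto simp: S2_def)
        show "E \<inter> A \<times> (?B - E `` A) = {}" by auto
      qed
    qed
    \<comment> \<open>\<open>S2\<close> sees only \<open>Q2\<close> but not \<open>R\<close>, and
      \<open>Q2 - R\<close> sees only \<open>S2\<close>, so \<open>C\<close> is closed; it misses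
      \<open>T\<close>, which is nonempty.\<close>
    define C where "C = S2 \<union> (Q2 - R)"
    have "E `` C \<subseteq> C"
      using S2nbrs Q2nbrs RS2' commute unfolding C_def R_def by blast
    moreover have "C \<subseteq> X \<union> Y" using parts Q12 by (auto simp: C_def S2_def)
    moreover have "C \<noteq> {}" using \<open>S2 \<noteq> {}\<close> by (simp add: C_def)
    ultimately have "C = X \<union> Y" using conn by blast
    moreover obtain t where "t \<in> T" using less(2) by (metis card.empty ex_in_conv not_less_zero)
    moreover from this have "t \<notin> C" using parts Q12 disjoint by (auto simp: C_def S2_def)
    ultimately show ?thesis using parts by auto
  qed
qed

end

section \<open>Connecting the components of a factor\<close>

context bipartite_relation
begin

definition factor :: "nat \<Rightarrow> 'a rel \<Rightarrow> bool" where
  "factor k F \<longleftrightarrow> F \<subseteq> E \<and> sym F \<and> (\<forall>v\<in>X \<union> Y. card (F `` {v}) = k)"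

text \<open>If \<open>a\<close> were unreachable, the \<open>F\<close>-edges at the
  \<open>X\<close>-side \<open>A\<close> of the component of \<open>x\<close> in \<open>G\<close>
  would be those at its \<open>Y\<close>-side \<open>B\<close> together with \<open>xa\<close>, so
  \<open>k * card A = k * card B + 1\<close>. The hypothesis on \<open>F - G\<close> is local to
  that component because the swap deletes two edges at once.\<close>

lemma factor_no_bridge_X:
  assumes F: "factor k F" and k: "2 \<le> k" and x: "x \<in> X" "(x, a) \<in> F" and G: "G \<subseteq> F"
    and F_G: "\<And>u v. (x, u) \<in> G\<^sup>* \<Longrightarrow> (u, v) \<in> F - G \<Longrightarrow> (u, v) = (x, a) \<or> (u, v) = (a, x)"
  shows "(x, a) \<in> G\<^sup>*"
proof (rule ccontr)
  assume a: "(x, a) \<notin> G\<^sup>*"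
  have FE: "F \<subseteq> E" and sF: "F\<inverse> = F" and d: "\<And>v. v \<in> X \<union> Y \<Longrightarrow> card (F `` {v}) = k"
    using F by (auto simp: factor_def sym_conv_converse_eq)
  have finF: "finite F" using FE finite_arcs finite_subset by blast
  define A B where "A = G\<^sup>* `` {x} \<inter> X" and "B = G\<^sup>* `` {x} \<inter> Y"
  have fin: "finite A" "finite B" using finite_parts by (auto simp: A_def B_def)
  have step: "v \<in> G\<^sup>* `` {x} \<or> (u, v) = (x, a)" if "u \<in> G\<^sup>* `` {x}" "(u, v) \<in> F" for u v
    using F_G[of u v] that a by (auto intro: rtrancl_into_rtrancl)
  have XY: "(u \<in> X \<and> v \<in> Y) \<or> (u \<in> Y \<and> v \<in> X)" if "(u, v) \<in> F" for u v
    using that FE arcs by auto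
  have "v \<in> B \<or> (u, v) = (x, a)" if "u \<in> A" "(u, v) \<in> F" for u v
    using step[of u v] XY[of u v] that disjoint unfolding A_def B_def by blast
  moreover have "x \<in> A" using x by (simp add: A_def)
  ultimately have "F \<inter> A \<times> UNIV = insert (x, a) (F \<inter> A \<times> B)" using x(2) by auto
  moreover have "(x, a) \<notin> F \<inter> A \<times> B" using a by (auto simp: B_def)
  ultimately have "card (F \<inter> A \<times> UNIV) = Suc (card (F \<inter> A \<times> B))" using finF by simp
  moreover have "F \<inter> UNIV \<times> B = F \<inter> A \<times> B"
  proof -
    have "u \<in> A" if uv: "(u, v) \<in> F" "v \<in> B" for u v
    proof -
      have "(v, u) \<in> F" using uv sF by auto
      then show ?thesis using step[of v u] XY[of v u] uv x disjoint unfolding A_def B_def by blast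
    qed
    then show ?thesis by auto
  qed
  moreover have "card (F \<inter> A \<times> UNIV) = k * card A"
    using card_rel_eq_sum_Image[OF fin(1) finF] d by (simp add: A_def)
  moreover have "card (F \<inter> UNIV \<times> B) = k * card B"
    using card_rel_eq_sum_Image'[OF fin(2) finF] d by (simp add: B_def sF)
  ultimately have "k * card A = k * card B + 1" by simp
  then have "k dvd 1" by (metis dvd_add_right_iff dvd_triv_left)
  then show False using k by simp
qed

lemma factor_no_bridge:
  assumes F: "factor k F" and k: "2 \<le> k" and x: "(x, a) \<in> F" and G: "G \<subseteq> F"
    and F_G: "\<And>u v. (x, u) \<in> G\<^sup>* \<Longrightarrow> (u, v) \<in> F - G \<Longrightarrow> (u, v) = (x, a) \<or> (u, v) = (a, x)"
  shows "(x, a) \<in> G\<^sup>*"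
proof -
  \<comment> \<open>Interchanging the parts covers the case \<open>x \<in> Y\<close>.\<close>
  interpret opp: bipartite_relation E Y X
    using finite_parts disjoint arcs sym by unfold_locales auto
  have "opp.factor k F" using F by (auto simp: factor_def opp.factor_def)
  moreover have "x \<in> X \<or> x \<in> Y" using x F arcs by (auto simp: factor_def)
  ultimately show ?thesis
    using factor_no_bridge_X[OF F k _ x G F_G] opp.factor_no_bridge_X[OF _ k _ x G F_G] by blast
qed

text \<open>Each of the four vertices trades one neighbour for another, so degrees persist. The
  deleted edges lie in different components of \<open>F\<close> and neither is a bridge, so no
  connection is lost.\<close>

lemma factor_swap:
  assumes F: "factor k F" and k: "2 \<le> k" and xy: "(x, y) \<in> E" "(x, y) \<notin> F\<^sup>*"
    and xa: "(x, a) \<in> F" and yb: "(y, b) \<in> F" and ab: "(a, b) \<in> E"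
  shows "\<exists>F'. factor k F' \<and> F\<^sup>* \<subseteq> F'\<^sup>* \<and> (x, y) \<in> F'\<^sup>*"
proof -
  have FE: "F \<subseteq> E" and sF: "sym F" and d: "\<And>v. v \<in> X \<union> Y \<Longrightarrow> card (F `` {v}) = k"
    using F by (auto simp: factor_def)
  have sFr: "(v, u) \<in> F\<^sup>*" if "(u, v) \<in> F\<^sup>*" for u v
    using that sF by (meson sym_rtrancl symD)
  have tr: "(u, w) \<in> F\<^sup>*" if "(u, v) \<in> F\<^sup>*" "(v, w) \<in> F\<^sup>*" for u v w
    using that by (rule rtrancl_trans)
  define D where "D = {(x, a), (a, x), (y, b), (b, y)}"
  define G where "G = F - D"
  define F' where "F' = G \<union> {(x, y), (y, x), (a, b), (b, a)}"
  have sG: "sym G" using sF by (auto simp: G_def D_def sym_def)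
  have inF: "(a, x) \<in> F" "(b, y) \<in> F" using xa yb sF by (auto dest: symD)
  have F4: "(x, a) \<in> F\<^sup>*" "(a, x) \<in> F\<^sup>*" "(y, b) \<in> F\<^sup>*" "(b, y) \<in> F\<^sup>*"
    using xa yb inF by auto
  \<comment> \<open>Since \<open>a\<close> and \<open>b\<close> lie in the components of
    \<open>x\<close> and \<open>y\<close>, the new edge \<open>ab\<close> also crosses; this keeps
    the four vertices distinct and both new edges outside \<open>F\<close>.\<close>
  have ab_n: "(a, b) \<notin> F\<^sup>*" using F4 xy tr by blast
  have ne: "x \<noteq> y" "a \<noteq> b" "x \<noteq> b" "y \<noteq> a" using xy F4 ab_n sFr by auto
  have ne2: "x \<noteq> a" "y \<noteq> b" using xa yb FE arcs disjoint by auto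
  have nF: "(x, y) \<notin> F" "(y, x) \<notin> F" "(a, b) \<notin> F" "(b, a) \<notin> F"
    using xy(2) ab_n sFr by auto
  have finI: "finite (F `` {v})" for v
    using FE finite_arcs finite_subset by (metis finite_Image)
  have "card (F' `` {v}) = card (F `` {v})" for v
  proof -
    consider "v = x" | "v = a" | "v = y" | "v = b" | "v \<noteq> x" "v \<noteq> a" "v \<noteq> y" "v \<noteq> b" by blast
    then show ?thesis
    proof cases
      case 1
      then have eq: "F' `` {v} = insert y (F `` {v} - {a})"
        using ne ne2 by (auto simp: F'_def G_def D_def)
      show ?thesis unfolding eq by (rule card_insert_remove1) (use 1 xa nF finI in auto)
    next
      case 2
      then have eq: "F' `` {v} = insert b (F `` {v} - {x})"
        using ne ne2 by (auto simp: F'_def G_def D_def)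
      show ?thesis unfolding eq by (rule card_insert_remove1) (use 2 inF nF finI in auto)
    next
      case 3
      then have eq: "F' `` {v} = insert x (F `` {v} - {b})"
        using ne ne2 by (auto simp: F'_def G_def D_def)
      show ?thesis unfolding eq by (rule card_insert_remove1) (use 3 yb nF finI in auto)
    next
      case 4
      then have eq: "F' `` {v} = insert a (F `` {v} - {y})"
        using ne ne2 by (auto simp: F'_def G_def D_def)
      show ?thesis unfolding eq by (rule card_insert_remove1) (use 4 inF nF finI in auto)
    next
      case 5
      then have "F' `` {v} = F `` {v}" by (auto simp: F'_def G_def D_def)
      then show ?thesis by simp
    qed
  qed
  moreover have "F' \<subseteq> E" using FE xy ab commute by (auto simp: F'_def G_def)
  moreover have "sym F'" using sG by (auto simp: F'_def sym_def)
  ultimately have "factor k F'" using d by (simp add: factor_def)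
  moreover have "F\<^sup>* \<subseteq> F'\<^sup>*"
  proof (rule rtrancl_subset_rtrancl)
    have GF: "G \<subseteq> F" by (auto simp: G_def)
    then have GF': "(u, v) \<in> F\<^sup>*" if "(u, v) \<in> G\<^sup>*" for u v using that rtrancl_mono by blast
    have "(x, a) \<in> G\<^sup>*"
    proof (rule factor_no_bridge[OF F k xa GF])
      fix u v assume "(x, u) \<in> G\<^sup>*" "(u, v) \<in> F - G"
      moreover have "(x, b) \<notin> F\<^sup>*" using xy(2) F4 tr by blast
      ultimately show "(u, v) = (x, a) \<or> (u, v) = (a, x)"
        using xy(2) GF' by (auto simp: G_def D_def)
    qed
    moreover have "(y, b) \<in> G\<^sup>*"
    proof (rule factor_no_bridge[OF F k yb GF])
      fix u v assume "(y, u) \<in> G\<^sup>*" "(u, v) \<in> F - G"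
      moreover have "(y, x) \<notin> F\<^sup>*" "(y, a) \<notin> F\<^sup>*" using xy(2) F4 tr sFr by blast+
      ultimately show "(u, v) = (y, b) \<or> (u, v) = (b, y)"
        using GF' by (auto simp: G_def D_def)
    qed
    moreover have "sym (G\<^sup>*)" using sG by (rule sym_rtrancl)
    ultimately have "D \<subseteq> G\<^sup>*" by (auto simp: D_def dest: symD)
    moreover have "F - D \<subseteq> G\<^sup>*" by (auto simp: G_def)
    ultimately have "F \<subseteq> G\<^sup>*" by blast
    also have "\<dots> \<subseteq> F'\<^sup>*" by (rule rtrancl_mono) (auto simp: F'_def)
    finally show "F \<subseteq> F'\<^sup>*" .
  qed
  moreover have "(x, y) \<in> F'\<^sup>*" by (auto simp: F'_def)
  ultimately show ?thesis by blast
qed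

lemma unswappable_factor_exists:
  assumes "factor k F0" "2 \<le> k"
  obtains F where "factor k F"
    "\<And>x y a b. (x, y) \<in> E \<Longrightarrow> (x, y) \<notin> F\<^sup>* \<Longrightarrow> (x, a) \<in> F \<Longrightarrow> (y, b) \<in> F \<Longrightarrow> (a, b) \<notin> E"
proof -
  let ?V = "X \<union> Y"
  \<comment> \<open>\<open>F\<^sup>*\<close> is reflexive on the whole type, so it is cut down to
    the vertex set to be finite.\<close>
  let ?f = "\<lambda>F. card (F\<^sup>* \<inter> ?V \<times> ?V)"
  have finV: "finite (?V \<times> ?V)" using finite_parts by simp
  then have "\<forall>F. factor k F \<longrightarrow> ?f F < Suc (card (?V \<times> ?V))"
    by (simp add: card_mono less_Suc_eq_le)
  then obtain F where F: "factor k F" and max: "\<And>F'. factor k F' \<Longrightarrow> ?f F' \<le> ?f F"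
    using ex_has_greatest_nat[of "factor k" F0 ?f] assms(1) by blast
  have "(a, b) \<notin> E" if xy: "(x, y) \<in> E" "(x, y) \<notin> F\<^sup>*" "(x, a) \<in> F" "(y, b) \<in> F" for x y a b
  proof
    assume "(a, b) \<in> E"
    then obtain F' where F': "factor k F'" "F\<^sup>* \<subseteq> F'\<^sup>*" "(x, y) \<in> F'\<^sup>*"
      using factor_swap[OF F assms(2) xy] by blast
    have "(x, y) \<in> ?V \<times> ?V" using xy(1) arcs by auto
    then have "F\<^sup>* \<inter> ?V \<times> ?V \<subset> F'\<^sup>* \<inter> ?V \<times> ?V" using F' xy(2) by blast
    then have "?f F < ?f F'" using finV by (intro psubset_card_mono) auto
    then show False using max[OF F'(1)] by simp
  qed
  then show ?thesis using that F by blast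
qed

end

section \<open>Bounding the edges that cross between components\<close>

context double_star_free_relation
begin

lemma no_large_double_star':
  assumes "(x, y) \<in> E" "A \<subseteq> E `` {x} - {y}" "B \<subseteq> E `` {y} - {x}" "k \<le> card A" "l \<le> card B"
    "\<And>a b. a \<in> A \<Longrightarrow> b \<in> B \<Longrightarrow> (a, b) \<notin> E"
  shows False
  using no_large_double_star[OF assms(1-5)] assms(6) by blast

text \<open>The pairs with \<open>R i j\<close> among the crossing neighbours \<open>Z\<close> of
  \<open>x\<close> are counted twice. Each \<open>j\<close> fails for at most \<open>m + 1\<close>
  vertices \<open>i\<close>, itself included, and each \<open>i\<close> has at most
  \<open>k * (k - 1) + m * k\<close> partners \<open>j\<close>. Here \<open>m = l - k - 1\<close>,
  so more than \<open>m\<close> leaves besides the \<open>k\<close> given by \<open>F\<close> amount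
  to \<open>l\<close>.\<close>

lemma crossing_nbrs_le:
  assumes F: "factor k F"
    and F_max: "\<And>x y a b. (x, y) \<in> E \<Longrightarrow> (x, y) \<notin> F\<^sup>* \<Longrightarrow> (x, a) \<in> F \<Longrightarrow> (y, b) \<in> F \<Longrightarrow> (a, b) \<notin> E"
    and l: "l = k + Suc m"
  shows "card (E `` {x} - F\<^sup>* `` {x}) \<le> k * (k - 1) + m * k + Suc m"
proof -
  have FE: "F \<subseteq> E" and sF: "sym F" and d: "\<And>v. v \<in> X \<union> Y \<Longrightarrow> card (F `` {v}) = k"
    using F by (auto simp: factor_def)
  have dF: "card (F `` {v}) = k" if "(u, v) \<in> E \<or> (v, u) \<in> E" for u v
    using that arcs by (intro d) auto
  have finI: "finite (F `` A)" for A
    using FE finite_arcs finite_subset by (metis finite_Image)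
  have sF': "(v, u) \<in> F" if "(u, v) \<in> F" for u v using that sF by (auto dest: symD)
  define Z where "Z = E `` {x} - F\<^sup>* `` {x}"
  have finZ: "finite Z" using finite_nbrs by (simp add: Z_def)
  have Z: "(x, z) \<in> E" "(z, x) \<in> E" "(x, z) \<notin> F\<^sup>*" "(x, z) \<notin> F" "(z, x) \<notin> F" if "z \<in> Z" for z
    using that commute sF' by (auto simp: Z_def)
  have AW: "(a, w) \<notin> E" "(w, a) \<notin> E" if "a \<in> F `` {x}" "z \<in> Z" "w \<in> F `` {z}" for a z w
    using F_max[OF Z(1,3), of z a w] that commute by auto
  let ?A = "F `` {x}"
  \<comment> \<open>Otherwise \<open>x\<close> with leaves \<open>?A\<close> and \<open>?M\<close>,
    and \<open>j\<close> with leaves \<open>F\<close>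
    {j}\<open>, form a double star; unswappability excludes edges from\<close>?A\<open>to\<close>F
    \<open>{j}\<close>.\<close>
  have M: "card {i \<in> Z. i \<noteq> j \<and> E `` {i} \<inter> F `` {j} = {}} \<le> m" (is "card ?M \<le> m") if j: "j \<in> Z" for j
  proof (rule ccontr)
    assume m: "\<not> card ?M \<le> m"
    show False
    proof (rule no_large_double_star'[OF Z(2)[OF j], of "F `` {j}" "?A \<union> ?M"])
      show "F `` {j} \<subseteq> E `` {j} - {x}" using FE Z[OF j] by auto
      show "?A \<union> ?M \<subseteq> E `` {x} - {j}" using FE Z[OF j] by (auto simp: Z_def)
      show "k \<le> card (F `` {j})" using dF[of x j] Z[OF j] by simp
      have "finite ?M" using finZ by simp
      moreover have "?A \<inter> ?M = {}" by (auto simp: Z_def)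
      ultimately have "card (?A \<union> ?M) = card ?A + card ?M" using finI card_Un_disjoint by blast
      then show "l \<le> card (?A \<union> ?M)" using m l dF[of j x] Z[OF j] by simp
      show "(w, b) \<notin> E" if "w \<in> F `` {j}" "b \<in> ?A \<union> ?M" for w b
        using that AW[OF _ j] commute by blast
    qed
  qed
  define W where "W = F `` Z"
  \<comment> \<open>Now the side with \<open>l\<close> leaves sits at \<open>i\<close>: every vertex
    of \<open>W\<close> is an \<open>F\<close>-neighbour of a crossing neighbour of
    \<open>x\<close>, hence not adjacent to \<open>?A\<close>.\<close>
  have N: "card (E `` {i} \<inter> W - F `` {i}) \<le> m" (is "card ?N \<le> m") if i: "i \<in> Z" for i
  proof (rule ccontr)
    assume m: "\<not> card ?N \<le> m"
    show False
    proof (rule no_large_double_star'[OF Z(1)[OF i], of ?A "F `` {i} \<union> ?N"])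
      show "?A \<subseteq> E `` {x} - {i}" using FE Z[OF i] by auto
      show "F `` {i} \<union> ?N \<subseteq> E `` {i} - {x}" using FE Z Z[OF i] by (auto simp: W_def)
      show "k \<le> card ?A" using dF[of i x] Z[OF i] by simp
      have "card (F `` {i} \<union> ?N) = card (F `` {i}) + card ?N"
        using finI finite_nbrs by (intro card_Un_disjoint) auto
      then show "l \<le> card (F `` {i} \<union> ?N)" using m l dF[of x i] Z[OF i] by simp
      show "(a, b) \<notin> E" if "a \<in> ?A" "b \<in> F `` {i} \<union> ?N" for a b
        using that AW i unfolding W_def by blast
    qed
  qed
  define R where "R = (\<lambda>i j. i \<noteq> j \<and> E `` {i} \<inter> F `` {j} \<noteq> {})"
  have "card Z \<le> card {i \<in> Z. R i j} + Suc m" if j: "j \<in> Z" for j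
  proof -
    let ?M = "{i \<in> Z. i \<noteq> j \<and> E `` {i} \<inter> F `` {j} = {}}"
    have "Z = {i \<in> Z. R i j} \<union> (?M \<union> {j})" using j by (auto simp: R_def)
    then have "card Z = card ({i \<in> Z. R i j} \<union> (?M \<union> {j}))" by (rule arg_cong)
    also have "\<dots> \<le> card {i \<in> Z. R i j} + card (?M \<union> {j})" by (rule card_Un_le)
    also have "card (?M \<union> {j}) \<le> card ?M + 1" using card_Un_le[of ?M "{j}"] by simp
    finally show ?thesis using M[OF j] by simp
  qed
  then have "(\<Sum>j\<in>Z. card Z) \<le> (\<Sum>j\<in>Z. card {i \<in> Z. R i j} + Suc m)" by (rule sum_mono)
  then have le: "card Z * card Z \<le> (\<Sum>j\<in>Z. card {i \<in> Z. R i j}) + card Z * Suc m"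
    by (simp only: sum.distrib sum_constant of_nat_id)
  have "(\<Sum>j\<in>Z. card {i \<in> Z. R i j}) = (\<Sum>i\<in>Z. card {j \<in> Z. R i j})"
    by (rule sum_multicount_gen) (use finZ in auto)
  also have "\<dots> \<le> (\<Sum>i\<in>Z. k * (k - 1) + m * k)"
  proof (rule sum_mono)
    fix i assume i: "i \<in> Z"
    let ?N = "E `` {i} \<inter> W - F `` {i}"
    \<comment> \<open>The common vertex \<open>w\<close> is an \<open>F\<close>-neighbour of
      \<open>i\<close>, leaving \<open>k - 1\<close> choices of \<open>j\<close>, or one of at most
      \<open>m\<close> others with \<open>k\<close> choices each.\<close>
    have "{j \<in> Z. R i j} \<subseteq> (\<Union>w\<in>F `` {i}. F `` {w} - {i}) \<union> (\<Union>w\<in>?N. F `` {w})"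
      using sF' by (auto simp: R_def W_def)
    then have "card {j \<in> Z. R i j} \<le> card ((\<Union>w\<in>F `` {i}. F `` {w} - {i}) \<union> (\<Union>w\<in>?N. F `` {w}))"
      using finI finite_nbrs by (intro card_mono) auto
    also have "\<dots> \<le> card (\<Union>w\<in>F `` {i}. F `` {w} - {i}) + card (\<Union>w\<in>?N. F `` {w})"
      by (rule card_Un_le)
    also have "card (\<Union>w\<in>F `` {i}. F `` {w} - {i}) \<le> (\<Sum>w\<in>F `` {i}. card (F `` {w} - {i}))"
      by (rule card_UN_le) (rule finI)
    also have "\<dots> = (\<Sum>w\<in>F `` {i}. k - 1)"
    proof (rule sum.cong)
      fix w assume w: "w \<in> F `` {i}"
      then have "i \<in> F `` {w}" using sF' by auto
      moreover have "card (F `` {w}) = k" using w FE by (intro dF[of i]) auto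
      ultimately show "card (F `` {w} - {i}) = k - 1" by simp
    qed simp
    also have "\<dots> = k * (k - 1)" using dF[of x i] Z[OF i] by simp
    also have "card (\<Union>w\<in>?N. F `` {w}) \<le> (\<Sum>w\<in>?N. card (F `` {w}))"
      using finite_nbrs by (intro card_UN_le) auto
    also have "\<dots> = (\<Sum>w\<in>?N. k)" using dF[of i] by (intro sum.cong) auto
    also have "\<dots> \<le> m * k" using N[OF i] by simp
    finally show "card {j \<in> Z. R i j} \<le> k * (k - 1) + m * k" by simp
  qed
  also have "\<dots> = card Z * (k * (k - 1) + m * k)" by simp
  finally have "card Z * card Z \<le> card Z * (k * (k - 1) + m * k + Suc m)"
    using le unfolding distrib_left[of "card Z" _ "Suc m"] by linarith
  then have "0 < card Z \<longrightarrow> card Z \<le> k * (k - 1) + m * k + Suc m"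
    by (simp only: mult_le_cancel1)
  then show ?thesis unfolding Z_def[symmetric] by (cases "0 < card Z") auto
qed

text \<open>A crossing edge \<open>xy\<close> would bound the degree of \<open>x\<close> by
  \<open>k + r + m + k * r\<close>. The degree hypothesis is guarded by \<open>k < l\<close> because
  at \<open>k = l\<close> truncated subtraction departs from the integer formula.\<close>

lemma unswappable_factor_connects:
  assumes F: "factor k F"
    and F_max: "\<And>x y a b. (x, y) \<in> E \<Longrightarrow> (x, y) \<notin> F\<^sup>* \<Longrightarrow> (x, a) \<in> F \<Longrightarrow> (y, b) \<in> F \<Longrightarrow> (a, b) \<notin> E"
    and deg: "\<And>v. v \<in> X \<union> Y \<Longrightarrow> k < l \<Longrightarrow> (k ^ 3 + 1) * (2 * (l - k) - 1) + l \<le> card (E `` {v})"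
  shows "E \<subseteq> F\<^sup>*"
proof (rule ccontr)
  assume "\<not> E \<subseteq> F\<^sup>*"
  then obtain x y where xy: "(x, y) \<in> E" "(x, y) \<notin> F\<^sup>*" by auto
  have FE: "F \<subseteq> E" and sF: "sym F" and d: "\<And>v. v \<in> X \<union> Y \<Longrightarrow> card (F `` {v}) = k"
    using F by (auto simp: factor_def)
  have V: "x \<in> X \<union> Y" "y \<in> X \<union> Y" using xy(1) arcs by auto
  have yx: "(y, x) \<in> E" "(x, y) \<notin> F" "(y, x) \<notin> F" using xy commute sF by (auto dest: symD)
  let ?A = "F `` {x}" and ?B = "F `` {y}"
  have AB: "(a, b) \<notin> E" "(b, a) \<notin> E" if "a \<in> ?A" "b \<in> ?B" for a b
    using F_max[OF xy] that commute by auto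
  have A: "?A \<subseteq> E `` {x} - {y}" and B: "?B \<subseteq> E `` {y} - {x}"
    using FE yx by auto
  have finI: "finite (F `` A)" for A
    using FE finite_arcs finite_subset by (metis finite_Image)
  show False
  proof (cases "k = l")
    case True
    then show False using no_large_double_star'[OF xy(1) A B] AB d V by simp
  next
    case False
    then obtain m where l: "l = k + Suc m" using kl by (metis less_iff_Suc_add le_neq_implies_less add_Suc_right)
    let ?Z = "\<lambda>v. E `` {v} - F\<^sup>* `` {v}"
    define r where "r = k * (k - 1) + m * k + Suc m"
    have r: "card (?Z v) \<le> r" for v
      using crossing_nbrs_le[OF F F_max l] by (simp add: r_def)
    let ?M = "{z \<in> E `` {x}. z \<notin> ?A \<and> z \<noteq> y \<and> E `` {z} \<inter> ?B = {}}"
    have M: "card ?M \<le> m"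
    proof (rule ccontr)
      assume m: "\<not> card ?M \<le> m"
      show False
      proof (rule no_large_double_star'[OF yx(1) B, of "?A \<union> ?M"])
        show "?A \<union> ?M \<subseteq> E `` {x} - {y}" using A by auto
        show "k \<le> card ?B" using d V by simp
        have "card (?A \<union> ?M) = card ?A + card ?M"
          using finI finite_nbrs[of "{x}"] by (intro card_Un_disjoint) (auto elim: rev_finite_subset)
        then show "l \<le> card (?A \<union> ?M)" using m l d V by simp
        show "(b, a) \<notin> E" if "b \<in> ?B" "a \<in> ?A \<union> ?M" for a b
          using that AB commute by blast
      qed
    qed
    \<comment> \<open>A neighbour \<open>z\<close> outside the first three sets lies in the
      component of \<open>x\<close> and has a neighbour \<open>b\<close> in \<open>?B\<close>, which
      lies in that of \<open>y\<close>; so \<open>bz\<close> crosses. The vertex \<open>y\<close>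
      itself belongs to \<open>?Z x\<close>.\<close>
    have "E `` {x} \<subseteq> ?A \<union> ?Z x \<union> ?M \<union> (\<Union>b\<in>?B. ?Z b)"
    proof
      fix z assume z: "z \<in> E `` {x}"
      show "z \<in> ?A \<union> ?Z x \<union> ?M \<union> (\<Union>b\<in>?B. ?Z b)"
      proof (rule ccontr)
        assume n: "z \<notin> ?A \<union> ?Z x \<union> ?M \<union> (\<Union>b\<in>?B. ?Z b)"
        then have xz: "(x, z) \<in> F\<^sup>*" using z by auto
        then have "z \<noteq> y" using xy by auto
        then obtain b where b: "(z, b) \<in> E" "(y, b) \<in> F" using n z by auto
        then have "(b, z) \<in> F\<^sup>*" using n commute by auto
        then have "(z, b) \<in> F\<^sup>*" using sF by (meson sym_rtrancl symD)
        moreover have "(b, y) \<in> F\<^sup>*" using b(2) sF by (auto dest: symD)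
        ultimately show False using xz xy(2) by (meson rtrancl_trans)
      qed
    qed
    then have "card (E `` {x}) \<le> card (?A \<union> ?Z x \<union> ?M \<union> (\<Union>b\<in>?B. ?Z b))"
      using finI finite_nbrs finite_subset[OF _ finite_nbrs[of "{x}"], of ?M] by (intro card_mono) auto
    also have "\<dots> \<le> card ?A + card (?Z x) + card ?M + card (\<Union>b\<in>?B. ?Z b)"
      by (meson card_Un_le add_le_mono1 le_trans)
    also have "card (\<Union>b\<in>?B. ?Z b) \<le> (\<Sum>b\<in>?B. card (?Z b))" by (rule card_UN_le) (rule finI)
    also have "\<dots> \<le> (\<Sum>b\<in>?B. r)" using r by (rule sum_mono)
    also have "\<dots> = k * r" using d V by simp
    finally have "card (E `` {x}) \<le> k + r + m + k * r" using r[of x] M d V by simp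
    moreover have "(k ^ 3 + 1) * (2 * Suc m - 1) + l \<le> card (E `` {x})"
      using deg[of x] V l by simp
    moreover have "(k + 1) * r \<le> (k ^ 3 + 1) * (2 * Suc m - 1)"
    proof -
      \<comment> \<open>The cube comes from \<open>(k + 1) * (k * (k - 1) + 1) = k ^ 3 + 1\<close>;
        writing \<open>k = Suc j\<close> avoids subtraction.\<close>
      obtain j where k: "k = Suc j" using kl by (cases k) auto
      have "r \<le> (k * j + 1) * (2 * m + 1)" unfolding r_def k by (simp add: algebra_simps)
      then have "(k + 1) * r \<le> (k + 1) * ((k * j + 1) * (2 * m + 1))" by (rule mult_le_mono2)
      also have "\<dots> = (k ^ 3 + 1) * (2 * Suc m - 1)"
        unfolding k by (simp add: algebra_simps power3_eq_cube)
      finally show ?thesis .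
    qed
    ultimately show False using l by (simp add: algebra_simps)
  qed
qed

lemma connected_factor_exists:
  assumes XY: "card X = card Y"
    and deg: "\<And>v. v \<in> X \<union> Y \<Longrightarrow> 2 * (k * (k - 1) + l) \<le> card (E `` {v})"
      "\<And>v. v \<in> X \<union> Y \<Longrightarrow> k < l \<Longrightarrow> (k ^ 3 + 1) * (2 * (l - k) - 1) + l \<le> card (E `` {v})"
    and conn: "\<And>C. C \<subseteq> X \<union> Y \<Longrightarrow> C \<noteq> {} \<Longrightarrow> E `` C \<subseteq> C \<Longrightarrow> C = X \<union> Y"
  obtains F where "factor k F" "\<And>u v. u \<in> X \<union> Y \<Longrightarrow> v \<in> X \<union> Y \<Longrightarrow> (u, v) \<in> F\<^sup>*"
proof -
  obtain F0 where "F0 \<subseteq> E" "sym F0" "\<forall>v\<in>X \<union> Y. card (F0 `` {v}) = k"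
    by (rule regular_factor_exists[OF XY]) (use deg(1) conn in blast)+
  then have "factor k F0" by (simp add: factor_def)
  then obtain F where F: "factor k F"
    "\<And>x y a b. (x, y) \<in> E \<Longrightarrow> (x, y) \<notin> F\<^sup>* \<Longrightarrow> (x, a) \<in> F \<Longrightarrow> (y, b) \<in> F \<Longrightarrow> (a, b) \<notin> E"
    using unswappable_factor_exists kl(1) by metis
  then have EF: "E \<subseteq> F\<^sup>*" using unswappable_factor_connects deg(2) by metis
  have "(u, v) \<in> F\<^sup>*" if u: "u \<in> X \<union> Y" and v: "v \<in> X \<union> Y" for u v
  proof -
    let ?C = "F\<^sup>* `` {u} \<inter> (X \<union> Y)"
    have "E `` ?C \<subseteq> ?C" using EF arcs by (auto intro: rtrancl_trans)
    moreover have "?C \<noteq> {}" using u by blast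
    ultimately have "?C = X \<union> Y" using conn[of ?C] by blast
    then show ?thesis using v by blast
  qed
  then show ?thesis using that F(1) by blast
qed

end

section \<open>Transfer to graphs\<close>

lemma out_degree_with_proj: "out_degree (with_proj G) v = card (parcs G `` {v})"
proof -
  have "out_arcs (with_proj G) v = Pair v ` (parcs G `` {v})"
    by (auto simp: out_arcs_def)
  then show ?thesis by (simp add: out_degree_def card_image inj_on_def)
qed

text \<open>Connectedness of a digraph is defined through its symmetric closure, which adds nothing
  to a symmetric arc set.\<close>

lemma parcs_mk_symmetric_with_proj:
  "sym (parcs G) \<Longrightarrow> parcs (mk_symmetric (with_proj G)) = parcs G"
  by (fastforce simp: parcs_mk_symmetric dest: symD)

text \<open>This is the form in which connectedness of \<open>G\<close> reaches the combinatorial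
  argument, both for the factor and for its components.\<close>

lemma connected_with_proj_closed:
  assumes "Digraph_Component.connected (with_proj G)" "sym (parcs G)"
    and C: "C \<subseteq> pverts G" "C \<noteq> {}" "parcs G `` C \<subseteq> C"
  shows "C = pverts G"
proof -
  obtain u where u: "u \<in> C" using C by blast
  have "v \<in> C" if "v \<in> pverts G" for v
  proof -
    have "u \<rightarrow>\<^sup>*\<^bsub>with_proj (mk_symmetric (with_proj G))\<^esub> v"
      using assms(1) that u C(1)
      by (auto simp: Digraph_Component.connected_def strongly_connected_def)
    then have "(u, v) \<in> rtrancl_on (pverts G) (parcs G)"
      by (simp add: reachable_def parcs_mk_symmetric_with_proj assms(2))
    then have "(u, v) \<in> (parcs G)\<^sup>*" by (rule rtrancl_on_rtranclI)
    then show ?thesis using u C(3) by (induction rule: rtrancl_induct) auto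
  qed
  then show ?thesis using C(1) by blast
qed

lemma connected_with_projI:
  assumes "sym (parcs G)" "parcs G \<subseteq> pverts G \<times> pverts G" "pverts G \<noteq> {}"
    and "\<And>u v. u \<in> pverts G \<Longrightarrow> v \<in> pverts G \<Longrightarrow> (u, v) \<in> (parcs G)\<^sup>*"
  shows "Digraph_Component.connected (with_proj G)"
  unfolding Digraph_Component.connected_def
proof (rule strongly_connectedI)
  show "verts (with_proj (mk_symmetric (with_proj G))) \<noteq> {}" using assms(3) by simp
next
  fix u v
  assume "u \<in> verts (with_proj (mk_symmetric (with_proj G)))"
    "v \<in> verts (with_proj (mk_symmetric (with_proj G)))"
  then have "u \<in> pverts G" "v \<in> pverts G" by simp_all
  then have "(u, v) \<in> rtrancl_on (pverts G) (parcs G)"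
    using assms by (intro rtrancl_consistent_rtrancl_on) auto
  then show "u \<rightarrow>\<^sup>*\<^bsub>with_proj (mk_symmetric (with_proj G))\<^esub> v"
    by (simp add: reachable_def parcs_mk_symmetric_with_proj assms(1))
qed

section \<open>Realising the double star as an induced subgraph\<close>

lemma map_prod_image_Times: "map_prod f g ` (A \<times> B) = (f ` A) \<times> (g ` B)"
  by auto

text \<open>The bipartition forbids edges inside \<open>A\<close> or \<open>B\<close>, from
  \<open>x\<close> to \<open>B\<close> and from \<open>y\<close> to \<open>A\<close>. Once no edge
  joins \<open>A\<close> to \<open>B\<close>, the chosen vertices induce exactly the double
  star.\<close>

lemma induced_double_star_free:
  assumes wf: "wf_digraph (with_proj G)" and sym: "sym (parcs G)"
    and bip: "bipartition G X Y" and free: "induced_free (double_star k l) G"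
    and xy: "(x, y) \<in> parcs G"
    and A: "A \<subseteq> parcs G `` {x} - {y}" "card A = k"
    and B: "B \<subseteq> parcs G `` {y} - {x}" "card B = l"
    and pos: "0 < k" "0 < l"
  shows "parcs G \<inter> A \<times> B \<noteq> {}"
proof
  assume empty: "parcs G \<inter> A \<times> B = {}"
  let ?E = "parcs G"
  have comm: "(u, v) \<in> ?E \<longleftrightarrow> (v, u) \<in> ?E" for u v using sym by (auto dest: symD)
  have XY: "?E \<subseteq> X \<times> Y \<union> Y \<times> X" "X \<inter> Y = {}" using bip by (auto simp: bipartition_def)
  \<comment> \<open>Infinite sets have \<open>card\<close> equal to 0, so positivity of
    \<open>k\<close> and \<open>l\<close> gives finiteness.\<close>
  have fin: "finite A" "finite B" using A B pos by (auto intro: card_ge_0_finite)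
  define V where "V = {x, y} \<union> A \<union> B"
  define H where "H = \<lparr>pverts = V, parcs = ?E \<inter> V \<times> V\<rparr>"
  obtain U W where UW: "U \<inter> W = {}" "?E \<subseteq> U \<times> W \<union> W \<times> U" "x \<in> U" "y \<in> W"
  proof -
    consider "x \<in> X" "y \<in> Y" | "x \<in> Y" "y \<in> X" using xy XY by auto
    then show ?thesis
    proof cases
      case 1
      then show ?thesis using that[of X Y] XY by blast
    next
      case 2
      then show ?thesis using that[of Y X] XY by blast
    qed
  qed
  have AB: "A \<subseteq> W" "B \<subseteq> U" using A B UW by auto
  have notin: "x \<notin> A" "y \<notin> A" "x \<notin> B" "y \<notin> B" "x \<noteq> y" "A \<inter> B = {}"
    using A B AB UW by auto
  have arcsH: "?E \<inter> V \<times> V = {x} \<times> A \<union> A \<times> {x} \<union> ({y} \<times> B \<union> B \<times> {y}) \<union> {(x, y), (y, x)}"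
  proof (intro equalityI subsetI)
    fix e assume e: "e \<in> ?E \<inter> V \<times> V"
    obtain u v where uv: "e = (u, v)" by force
    have "(u \<in> U \<and> v \<in> W) \<or> (u \<in> W \<and> v \<in> U)" using e uv UW by auto
    then consider "u \<in> insert x B" "v \<in> insert y A" | "v \<in> insert x B" "u \<in> insert y A"
      using e uv AB UW unfolding V_def by blast
    then show "e \<in> {x} \<times> A \<union> A \<times> {x} \<union> ({y} \<times> B \<union> B \<times> {y}) \<union> {(x, y), (y, x)}"
      using e uv empty comm by cases auto
  next
    fix e assume "e \<in> {x} \<times> A \<union> A \<times> {x} \<union> ({y} \<times> B \<union> B \<times> {y}) \<union> {(x, y), (y, x)}"
    then show "e \<in> ?E \<inter> V \<times> V" using A B xy comm by (auto simp: V_def)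
  qed
  obtain g h where gh: "bij_betw g {1..k} A" "bij_betw h {1..l} B"
    using ex_bij_betw_nat_finite_1[OF fin(1)] ex_bij_betw_nat_finite_1[OF fin(2)] A B by auto
  define g' h' where "g' = the_inv_into {1..k} g" and "h' = the_inv_into {1..l} h"
  have gh': "bij_betw g' A {1..k}" "bij_betw h' B {1..l}"
    using gh bij_betw_the_inv_into by (auto simp: g'_def h'_def)
  \<comment> \<open>Centres receive label 0 and leaves positive labels. The last branch is meant for
    \<open>B\<close>, since \<open>f\<close> matters only on \<open>V\<close>.\<close>
  define f where "f = (\<lambda>v. if v = x then Inl 0 else if v = y then Inr 0
    else if v \<in> A then Inl (g' v) else Inr (h' v))"
  have fxy: "f x = Inl 0" "f y = Inr 0" using notin by (auto simp: f_def)
  have fA: "f ` A = Inl ` {1..k}"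
  proof -
    have "f ` A = Inl ` g' ` A" unfolding image_image by (rule image_cong) (use notin in \<open>auto simp: f_def\<close>)
    then show ?thesis using gh' by (simp add: bij_betw_def)
  qed
  have fB: "f ` B = Inr ` {1..l}"
  proof -
    have "f ` B = Inr ` h' ` B" unfolding image_image by (rule image_cong) (use notin in \<open>auto simp: f_def\<close>)
    then show ?thesis using gh' by (simp add: bij_betw_def)
  qed
  have "inj_on f V"
  proof (rule inj_onI)
    fix u v assume uv: "u \<in> V" "v \<in> V" "f u = f v"
    have pos: "0 < g' a" if "a \<in> A" for a using gh'(1) that by (fastforce simp: bij_betw_def)
    have pos': "0 < h' b" if "b \<in> B" for b using gh'(2) that by (fastforce simp: bij_betw_def)
    have inj: "inj_on g' A" "inj_on h' B" using gh' by (auto simp: bij_betw_def)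
    show "u = v"
      using uv pos[of u] pos[of v] pos'[of u] pos'[of v] inj_onD[OF inj(1), of u v] inj_onD[OF inj(2), of u v] notin
      unfolding f_def V_def by (auto split: if_splits)
  qed
  let ?hom = "\<lparr>iso_verts = f, iso_arcs = map_prod f f, iso_head = snd, iso_tail = fst\<rparr>"
  have wfH: "wf_digraph (with_proj H)"
    unfolding wf_digraph_wp_iff by unfold_locales (auto simp: H_def)
  have "pre_digraph.digraph_isomorphism (with_proj H) ?hom"
    unfolding pre_digraph.digraph_isomorphism_def
  proof (intro conjI)
    show "inj_on (iso_verts ?hom) (verts (with_proj H))" using \<open>inj_on f V\<close> by (simp add: H_def)
    have "inj_on (map_prod f f) (V \<times> V)" using \<open>inj_on f V\<close> map_prod_inj_on by blast
    then show "inj_on (iso_arcs ?hom) (arcs (with_proj H))" by (auto simp: H_def intro: inj_on_subset)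
  qed (use wfH in auto)
  moreover have "with_proj (double_star k l) = app_iso ?hom (with_proj H)"
  proof (rule pre_digraph.equality)
    have "f ` V = ({Inl 0} \<union> Inl ` {1..k}) \<union> ({Inr 0} \<union> Inr ` {1..l})"
      unfolding V_def image_Un fA fB by (auto simp: fxy)
    also have "\<dots> = {0..k} <+> {0..l}" by (auto simp: Plus_def)
    finally show "verts (with_proj (double_star k l)) = verts (app_iso ?hom (with_proj H))"
      by (simp add: H_def double_star_def star_def)
    show "arcs (with_proj (double_star k l)) = arcs (app_iso ?hom (with_proj H))"
      by (simp add: H_def arcsH image_Un map_prod_image_Times fA fB fxy double_star_def star_def)
  qed simp_all
  ultimately have "digraph_iso (with_proj H) (with_proj (double_star k l))"
    unfolding digraph_iso_def by blast
  moreover have "induced_subgraph (with_proj H) (with_proj G)"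
  proof -
    have "V \<subseteq> pverts G"
      using A B xy wf unfolding wf_digraph_wp_iff
      by (auto simp: V_def dest: pair_wf_digraph.in_arcsD1 pair_wf_digraph.in_arcsD2)
    then show ?thesis using wf wfH
      by (auto simp: induced_subgraph_def subgraph_def H_def)
  qed
  ultimately show False using free by (auto simp: induced_free_def)
qed

lemma connected_factor_in_double_star_free_graph:
  fixes G :: "'a pair_pre_digraph"
  assumes kl: "2 \<le> k" "k \<le> l"
    and G: "pair_graph G" "Digraph_Component.connected (with_proj G)" "balanced_bipartite G"
    and free: "induced_free (double_star k l) G"
    and deg: "max ((int k ^ 3 + 1) * (2 * int l - 2 * int k - 1) + int l)
      (2 * (int k ^ 2 - int k + int l)) \<le> int (min_degree G)"
  shows "\<exists>H. factor_of k H G \<and> Digraph_Component.connected (with_proj H)"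
proof -
  interpret G: pair_graph G by (rule G(1))
  obtain X Y where bip: "bipartition G X Y" and XY: "card X = card Y"
    using G(3) by (auto simp: balanced_bipartite_def)
  have V: "pverts G = X \<union> Y" using bip by (simp add: bipartition_def)
  have sym: "sym (parcs G)" using G.pair_sym_arcs by (simp add: symmetric_def)
  have wf: "wf_digraph (with_proj G)" by (rule G.wf_digraph)
  interpret B: double_star_free_relation "parcs G" X Y k l
  proof unfold_locales
    show "finite X" "finite Y" using G.pair_finite_verts V by auto
    show "X \<inter> Y = {}" "parcs G \<subseteq> X \<times> Y \<union> Y \<times> X" using bip by (auto simp: bipartition_def)
    show "sym (parcs G)" "2 \<le> k" "k \<le> l" by fact+
    show "parcs G \<inter> A \<times> B \<noteq> {}"
      if "(x, y) \<in> parcs G" "A \<subseteq> parcs G `` {x} - {y}" "B \<subseteq> parcs G `` {y} - {x}" "card A = k" "card B = l"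
      for x y A B
      using induced_double_star_free[OF wf sym bip free that(1) that(2,4) that(3,5)] kl by simp
  qed
  have deg_le: "int (min_degree G) \<le> int (card (parcs G `` {v}))" if "v \<in> X \<union> Y" for v
    using that G.pair_finite_verts V by (simp add: min_degree_def flip: out_degree_with_proj)
  have deg1: "2 * (k * (k - 1) + l) \<le> card (parcs G `` {v})" if "v \<in> X \<union> Y" for v
  proof -
    have "int (2 * (k * (k - 1) + l)) = 2 * (int k ^ 2 - int k + int l)"
      using kl by (simp add: of_nat_diff power2_eq_square algebra_simps)
    then have "int (2 * (k * (k - 1) + l)) \<le> int (card (parcs G `` {v}))"
      using deg deg_le[OF that] by linarith
    then show ?thesis by (simp only: of_nat_le_iff)
  qed
  have deg2: "(k ^ 3 + 1) * (2 * (l - k) - 1) + l \<le> card (parcs G `` {v})"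
    if "v \<in> X \<union> Y" "k < l" for v
  proof -
    \<comment> \<open>Here \<open>k < l\<close> keeps both natural-number subtractions from
      truncating.\<close>
    have "int (2 * (l - k) - 1) = 2 * int l - 2 * int k - 1" using that(2) by simp
    then have "int ((k ^ 3 + 1) * (2 * (l - k) - 1) + l)
        = (int k ^ 3 + 1) * (2 * int l - 2 * int k - 1) + int l"
      by (simp only: of_nat_add of_nat_mult of_nat_power of_nat_1)
    then have "int ((k ^ 3 + 1) * (2 * (l - k) - 1) + l) \<le> int (card (parcs G `` {v}))"
      using deg deg_le[OF that(1)] by linarith
    then show ?thesis by (simp only: of_nat_le_iff)
  qed
  have conn: "C = X \<union> Y" if "C \<subseteq> X \<union> Y" "C \<noteq> {}" "parcs G `` C \<subseteq> C" for C
    using connected_with_proj_closed[OF G(2) sym] that V by simp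
  obtain F where F: "B.factor k F" and FV: "\<And>u v. u \<in> X \<union> Y \<Longrightarrow> v \<in> X \<union> Y \<Longrightarrow> (u, v) \<in> F\<^sup>*"
  proof (rule B.connected_factor_exists[OF XY])
    show "2 * (k * (k - 1) + l) \<le> card (parcs G `` {v})" if "v \<in> X \<union> Y" for v
      using that by (rule deg1)
    show "(k ^ 3 + 1) * (2 * (l - k) - 1) + l \<le> card (parcs G `` {v})" if "v \<in> X \<union> Y" "k < l" for v
      using that by (rule deg2)
    show "C = X \<union> Y" if "C \<subseteq> X \<union> Y" "C \<noteq> {}" "parcs G `` C \<subseteq> C" for C
      using that by (rule conn)
  qed blast
  define H where "H = \<lparr>pverts = pverts G, parcs = F\<rparr>"
  have FG: "F \<subseteq> parcs G" and sF: "sym F" and d: "\<forall>v\<in>X \<union> Y. card (F `` {v}) = k"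
    using F by (auto simp: B.factor_def)
  have pH: "pair_graph H"
  proof unfold_locales
    show "finite (pverts H)" "finite (parcs H)"
      using G.pair_finite_verts G.pair_finite_arcs FG by (auto simp: H_def intro: finite_subset)
    show "symmetric (with_proj H)" using sF by (simp add: symmetric_def H_def)
    show "fst e \<in> pverts H" "snd e \<in> pverts H" "fst e \<noteq> snd e" if "e \<in> parcs H" for e
      using that FG G.arc_fst_in_verts G.arc_snd_in_verts G.pair_no_loops by (auto simp: H_def)
  qed
  interpret H: pair_graph H by (rule pH)
  have "factor_of k H G"
    unfolding factor_of_def regular_graph_def spanning_def subgraph_def
    using pH d V FG wf H.wf_digraph by (simp add: out_degree_with_proj compatibleI_with_proj) (simp add: H_def)
  moreover have "Digraph_Component.connected (with_proj H)"
  proof (rule connected_with_projI)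
    have "pverts G \<noteq> {}" using G(2) by (auto simp: Digraph_Component.connected_def strongly_connected_def)
    then show "pverts H \<noteq> {}" by (simp add: H_def)
    show "parcs H \<subseteq> pverts H \<times> pverts H"
      using H.in_arcsD1 H.in_arcsD2 by auto
    show "sym (parcs H)" "\<And>u v. u \<in> pverts H \<Longrightarrow> v \<in> pverts H \<Longrightarrow> (u, v) \<in> (parcs H)\<^sup>*"
      using sF FV V by (simp_all add: H_def)
  qed
  ultimately show ?thesis by blast
qed

theorem theorem1:
  fixes k l :: nat
  assumes "2 \<le> k" and "k \<le> l"
  shows "(\<exists>c::int. \<forall>G::'a pair_pre_digraph.
            pair_graph G \<and> Digraph_Component.connected (with_proj G) \<and> balanced_bipartite G \<and>
            induced_free (double_star k l) G \<and> int (min_degree G) \<ge> c \<longrightarrow>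
            (\<exists>H. factor_of k H G \<and> Digraph_Component.connected (with_proj H)))
       \<and> (\<forall>G::'a pair_pre_digraph.
            pair_graph G \<and> Digraph_Component.connected (with_proj G) \<and> balanced_bipartite G \<and>
            induced_free (double_star k l) G \<and>
            int (min_degree G) \<ge>
              max ((int k ^ 3 + 1) * (2 * int l - 2 * int k - 1) + int l)
                  (2 * (int k ^ 2 - int k + int l)) \<longrightarrow>
            (\<exists>H. factor_of k H G \<and> Digraph_Component.connected (with_proj H)))"
\<comment> \<open>The explicit bound of the second conjunct also serves as \<open>c\<close> in the
  first.\<close>
using connected_factor_in_double_star_free_graph[OF assms] by blast

end
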